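(* For every positive integer $k$ and every constant $A>0$ there is a constant $B_{A,k}>0$, depending only on $A$ and $k$, such that the following holds. Let $f$ be a real-valued function on an interval $[a,b]$ that is $\max(k,2)$ times continuously differentiable, and suppose that $$\sup_{[a,b]}|f^{(k)}(x)| < A\,\inf_{[a,b]}|f^{(k)}(x)|.$$ Let $\phi$ be a $C^1$ function on $[a,b]$. (i) If $k\ge 2$, then $$\left|\int_a^b e^{if(x)}\phi(x)\,dx\right| \le B_{A,k}\big(\|\phi\|_{L^\infty}+\|\phi'\|_{L^1}\big)\left(\int_a^b \min\left(1,\left|\frac{f''(x)}{(f'(x))^2}\right|\right)dx+\min\left(b-a,\frac{1}{\sup_{[a,b]}|f'(x)|}\right)\right).$$ (ii) If $k=1$ and $[a,b]$ is the union of $j$ intervals on each of which $f'$ is monotonic, then $$\left|\int_a^b e^{if(x)}\phi(x)\,dx\right| \le j\,B_{A,1}\big(\|\phi\|_{L^\infty}+\|\phi'\|_{L^1}\big)\left(\int_a^b \min\left(1,\left|\frac{f''(x)}{(f'(x))^2}\right|\right)dx+\min\left(b-a,\frac{1}{\sup_{[a,b]}|f'(x)|}\right)\right).$$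
   Context: Derivatives at the endpoints $a$, $b$ are the appropriate one-sided derivatives. The norms $\|\phi\|_{L^\infty}$ and $\|\phi'\|_{L^1}$ are taken over $[a,b]$. At points where $f'(x)=0$ the quantity $\min(1,|f''(x)/(f'(x))^2|)$ is interpreted as $1$. *)

theory Defs
  imports "HOL-Analysis.Analysis" "HOL-Probability.Essential_Supremum"
begin

text \<open>The derivative relative to a set; for \<open>S = {a..b}\<close> with \<open>a < b\<close> it is one-sided at the endpoints.\<close>

definition deriv_on :: "real set \<Rightarrow> (real \<Rightarrow> 'a::real_normed_vector) \<Rightarrow> real \<Rightarrow> 'a" where
  "deriv_on S f x = vector_derivative f (at x within S)"

definition higher_deriv_on :: "nat \<Rightarrow> real set \<Rightarrow> (real \<Rightarrow> 'a::real_normed_vector) \<Rightarrow> real \<Rightarrow> 'a" where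
  "higher_deriv_on n S f = (deriv_on S ^^ n) f"

definition cont_diff_on :: "nat \<Rightarrow> real set \<Rightarrow> (real \<Rightarrow> 'a::real_normed_vector) \<Rightarrow> bool" where
  "cont_diff_on n S f \<longleftrightarrow>
     (\<forall>m<n. higher_deriv_on m S f differentiable_on S) \<and> continuous_on S (higher_deriv_on n S f)"

text \<open>\<^const>\<open>real_of_ereal\<close> sends \<open>\<infinity>\<close> to 0, so the following is the usual norm only for essentially
  bounded functions, such as continuous functions on a compact interval.\<close>

definition Linf_norm :: "real set \<Rightarrow> (real \<Rightarrow> 'a::real_normed_vector) \<Rightarrow> real" where
  "Linf_norm S g = real_of_ereal (esssup (lebesgue_on S) (\<lambda>x. ereal (norm (g x))))"

definition L1_norm :: "real set \<Rightarrow> (real \<Rightarrow> 'a::real_normed_vector) \<Rightarrow> real" where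
  "L1_norm S g = integral S (\<lambda>x. norm (g x))"

definition amplitude_norm :: "real \<Rightarrow> real \<Rightarrow> (real \<Rightarrow> complex) \<Rightarrow> real" where
  "amplitude_norm a b \<phi> = Linf_norm {a..b} \<phi> + L1_norm {a..b} (deriv_on {a..b} \<phi>)"

text \<open>The explicit case \<open>f' = 0\<close> is needed because division by zero yields 0 in HOL, whereas the
  minimum has to be read as 1 there.\<close>

definition curvature_min :: "real \<Rightarrow> real \<Rightarrow> (real \<Rightarrow> real) \<Rightarrow> real \<Rightarrow> real" where
  "curvature_min a b f x =
     (if deriv_on {a..b} f x = 0 then 1
      else min 1 \<bar>higher_deriv_on 2 {a..b} f x / (deriv_on {a..b} f x)\<^sup>2\<bar>)"

text \<open>Under the hypothesis on \<open>f\<^sup>(\<^sup>k\<^sup>)\<close> with \<open>k \<ge> 1\<close>, \<open>f'\<close> is not identically zero,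
  so the last denominator is positive.\<close>

definition phase_bound :: "real \<Rightarrow> real \<Rightarrow> (real \<Rightarrow> real) \<Rightarrow> real" where
  "phase_bound a b f =
     integral {a..b} (curvature_min a b f)
       + min (b - a) (1 / (SUP x\<in>{a..b}. \<bar>deriv_on {a..b} f x\<bar>))"

definition monotonic_on :: "real set \<Rightarrow> (real \<Rightarrow> real) \<Rightarrow> bool" where
  "monotonic_on S g \<longleftrightarrow> mono_on S g \<or> antimono_on S g"

end

theory Submission
  imports Defs
begin

text \<open>
  Write \<open>J\<close> and \<open>T\<close> for the two summands of the bound. Integration by parts against the primitive
  of \<open>e\<^sup>i\<^sup>f\<close> removes \<open>\<phi>\<close>, so it is enough to bound the integrals of \<open>e\<^sup>i\<^sup>f\<close> over the intervals
  \<open>[a, x]\<close>.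

  For \<open>k \<ge> 2\<close>, a derivative is monotone where the next one has constant sign, hence changes sign at
  most once there; starting from \<open>f\<^sup>(\<^sup>k\<^sup>)\<close> this leaves \<open>2\<^sup>k\<^sup>-\<^sup>1\<close> intervals on which \<open>f'\<close> and \<open>f''\<close>
  have constant sign. On such an interval \<open>\<bar>f'\<bar>\<close> is monotone; cut it where \<open>\<bar>f'\<bar> = 1/r\<close>, with \<open>r\<close>
  the length of the flat part. The flat part contributes at most \<open>r\<close>, and by van der Corput's
  integration by parts the rest contributes \<open>O(r)\<close>. It remains to see \<open>r = O(J + T)\<close>. If
  \<open>\<bar>f'\<bar> \<le> 2/r\<close> throughout, then \<open>T \<ge> r/2\<close>. Otherwise \<open>\<bar>f'\<bar>\<close> climbs from \<open>1/r\<close> to \<open>2/r\<close> somewhere, and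
  a Landau-Kolmogorov inequality, using that \<open>f\<^sup>(\<^sup>k\<^sup>)\<close> has comparable extrema, gives \<open>f'' = O(1/r\<^sup>2)\<close> up
  to the end of the climb. Hence on the climb the minimum with 1 costs only a constant factor and
  \<open>J\<close> dominates the variation of \<open>1/f'\<close>, which is \<open>r/2\<close>.

  For \<open>k = 1\<close> the variation of \<open>1/f'\<close> is at most \<open>2 / inf \<bar>f'\<bar>\<close> on each monotonicity interval, and
  \<open>T\<close> alone suffices.
\<close>

section \<open>Derivatives and norms on an interval\<close>

lemma higher_deriv_on_has_vector_derivative:
  assumes "cont_diff_on n S f" "m < n" "x \<in> S"
  shows "(higher_deriv_on m S f has_vector_derivative higher_deriv_on (Suc m) S f x) (at x within S)"
  using assms
  by (auto simp: cont_diff_on_def higher_deriv_on_def deriv_on_def differentiable_on_def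
      simp flip: vector_derivative_works)

lemma cont_diff_on_imp_continuous_on:
  assumes "cont_diff_on n S f" "m \<le> n"
  shows "continuous_on S (higher_deriv_on m S f)"
  using assms by (cases "m = n") (auto simp: cont_diff_on_def intro!: differentiable_imp_continuous_on)

lemma has_real_derivative_higher_deriv_on:
  assumes "cont_diff_on n S f" "m < n" "x \<in> S"
  shows "(higher_deriv_on m S f has_real_derivative higher_deriv_on (Suc m) S f x) (at x within S)"
  using higher_deriv_on_has_vector_derivative[OF assms]
  by (simp add: has_real_derivative_iff_has_vector_derivative)

lemma cont_diff_on_two:
  assumes "cont_diff_on n {a..b} f" "2 \<le> n"
  shows "cont_diff_on 2 {a..b} f"
  using assms cont_diff_on_imp_continuous_on[OF assms] by (auto simp: cont_diff_on_def)

text \<open>The essential supremum controls the norm only off a null set. No nonempty open subset of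
  the interval is null, so the complement of that set is dense, and continuity carries the bound to
  every point.\<close>

lemma norm_le_Linf_norm:
  fixes g :: "real \<Rightarrow> 'a::real_normed_vector"
  assumes "a < b" "continuous_on {a..b} g" "x \<in> {a..b}"
  shows "norm (g x) \<le> Linf_norm {a..b} g"
proof -
  define e where "e = esssup (lebesgue_on {a..b}) (\<lambda>x. ereal (norm (g x)))"
  have cont: "continuous_on {a..b} (\<lambda>x. norm (g x))"
    using assms(2) by (rule continuous_on_norm)
  have "(\<lambda>x. norm (g x)) \<in> borel_measurable (lebesgue_on {a..b})"
    by (intro continuous_imp_measurable_on_sets_lebesgue cont) auto
  then have meas: "(\<lambda>x. ereal (norm (g x))) \<in> borel_measurable (lebesgue_on {a..b})"
    by measurable
  have AE: "AE x in lebesgue_on {a..b}. ereal (norm (g x)) \<le> e"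
    unfolding e_def by (rule esssup_AE)
  obtain N where N: "N \<in> null_sets (lebesgue_on {a..b})"
      "{x \<in> space (lebesgue_on {a..b}). \<not> ereal (norm (g x)) \<le> e} \<subseteq> N"
    using AE unfolding eventually_ae_filter by blast
  have neg: "negligible N"
    using N(1) by (simp add: null_sets_restrict_space negligible_iff_null_sets)
  define Z where "Z = {a..b} - N"
  have Z: "ereal (norm (g y)) \<le> e" if "y \<in> Z" for y
    using that N(2) by (auto simp: Z_def)
  have "{a..b} \<subseteq> closure Z"
  proof -
    have "{a<..<b} \<subseteq> closure Z"
    proof
      fix y assume y: "y \<in> {a<..<b}"
      show "y \<in> closure Z"
      proof (rule ccontr)
        assume "y \<notin> closure Z"
        then obtain \<epsilon> where "\<epsilon> > 0" "ball y \<epsilon> \<subseteq> - closure Z"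
          using openE[of "- closure Z" y] by auto
        then have "ball y \<epsilon> \<inter> Z = {}"
          using closure_subset[of Z] by blast
        then have "ball y \<epsilon> \<inter> {a<..<b} \<subseteq> N"
          by (auto simp: Z_def)
        then have "negligible (ball y \<epsilon> \<inter> {a<..<b})"
          using neg negligible_subset by blast
        then have "ball y \<epsilon> \<inter> {a<..<b} = {}"
          using open_not_negligible by (metis open_Int open_ball open_greaterThanLessThan)
        then show False using y \<open>\<epsilon> > 0\<close> by (metis Int_iff centre_in_ball empty_iff)
      qed
    qed
    then have "closure {a<..<b} \<subseteq> closure Z"
      by (simp add: closure_minimal)
    then show ?thesis using assms(1) by simp
  qed
  moreover have "closure Z \<subseteq> {a..b}"
    by (rule closure_minimal) (auto simp: Z_def)
  ultimately have clZ: "closure Z = {a..b}" by simp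
  obtain C where C: "\<And>y. y \<in> {a..b} \<Longrightarrow> norm (g y) \<le> C"
    using compact_imp_bounded[OF compact_continuous_image[OF assms(2)]]
    unfolding bounded_iff by blast
  \<comment> \<open>\<open>real_of_ereal\<close> would turn an infinite value into 0. The bound
    \<open>C\<close> excludes infinity from above, and a point of the nonempty set \<open>Z\<close>
    gives \<open>0 <= e\<close>.\<close>
  have e_le: "e \<le> ereal C"
    unfolding e_def using C by (intro esssup_I meas) (auto intro!: AE_I2)
  obtain z where "z \<in> Z" using clZ assms(3) by (metis closure_empty empty_iff ex_in_conv)
  then have "0 \<le> e"
    using Z[of z] by (metis ereal_less_eq(5) norm_ge_zero order_trans)
  then have fin: "e = ereal (real_of_ereal e)"
    using e_le by (cases e) auto
  have "norm (g x) \<le> real_of_ereal e"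
  proof (rule continuous_le_on_closure[where S = Z and f = "\<lambda>x. norm (g x)"])
    show "continuous_on (closure Z) (\<lambda>x. norm (g x))" using cont clZ by simp
    show "x \<in> closure Z" using clZ assms(3) by simp
    show "norm (g y) \<le> real_of_ereal e" if "y \<in> Z" for y
      using Z[OF that] fin by (metis ereal_less_eq(3))
  qed
  then show ?thesis by (simp add: Linf_norm_def e_def)
qed

text \<open>Integration by parts puts the derivative on the amplitude. The primitive
  \<open>U\<close> vanishes at \<open>a\<close>, so the boundary contributes only at
  \<open>b\<close>, which costs the sup norm; the remaining integral costs the L1 norm. This is why
  \<open>K\<close> must bound the integrals over all initial intervals.\<close>

lemma norm_integral_mult_le_amplitude_norm:
  fixes u \<phi> :: "real \<Rightarrow> complex"
  assumes "a < b" and u: "continuous_on {a..b} u" and \<phi>: "cont_diff_on 1 {a..b} \<phi>"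
    and K: "\<And>x. x \<in> {a..b} \<Longrightarrow> norm (integral {a..x} u) \<le> K"
  shows "norm (integral {a..b} (\<lambda>x. u x * \<phi> x)) \<le> K * amplitude_norm a b \<phi>"
proof -
  define U where "U = (\<lambda>x. integral {a..x} u)"
  define \<psi> where "\<psi> = deriv_on {a..b} \<phi>"
  have \<phi>': "(\<phi> has_vector_derivative \<psi> x) (at x within {a..b})" if "x \<in> {a..b}" for x
    using higher_deriv_on_has_vector_derivative[OF \<phi>, of 0 x] that
    by (simp add: higher_deriv_on_def \<psi>_def)
  have c\<phi>: "continuous_on {a..b} \<phi>" and c\<psi>: "continuous_on {a..b} \<psi>"
    using cont_diff_on_imp_continuous_on[OF \<phi>, of 0] cont_diff_on_imp_continuous_on[OF \<phi>, of 1]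
    by (simp_all add: higher_deriv_on_def \<psi>_def)
  have U': "(U has_vector_derivative u x) (at x within {a..b})" if "x \<in> {a..b}" for x
    unfolding U_def using u that by (rule integral_has_vector_derivative)
  have cU: "continuous_on {a..b} U"
    using U' by (rule continuous_on_vector_derivative)
  have "((\<lambda>x. U x * \<psi> x + u x * \<phi> x) has_integral (U b * \<phi> b - U a * \<phi> a)) {a..b}"
    using \<open>a < b\<close> by (intro fundamental_theorem_of_calculus)
      (auto intro!: has_vector_derivative_mult U' \<phi>')
  moreover have "(\<lambda>x. U x * \<psi> x) integrable_on {a..b}" "(\<lambda>x. u x * \<phi> x) integrable_on {a..b}"
    by (intro integrable_continuous_interval continuous_intros cU c\<psi> u c\<phi>)+
  ultimately have eq: "integral {a..b} (\<lambda>x. u x * \<phi> x) = U b * \<phi> b - integral {a..b} (\<lambda>x. U x * \<psi> x)"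
    using integral_add[of "\<lambda>x. U x * \<psi> x" "{a..b}" "\<lambda>x. u x * \<phi> x"]
    by (simp add: integral_unique U_def algebra_simps)
  have "norm (integral {a..b} (\<lambda>x. U x * \<psi> x)) \<le> integral {a..b} (\<lambda>x. K * norm (\<psi> x))"
    using K by (intro Henstock_Kurzweil_Integration.integral_norm_bound_integral integrable_continuous_interval
        continuous_intros cU c\<psi>) (auto simp: norm_mult U_def intro!: mult_right_mono)
  also have "\<dots> = K * L1_norm {a..b} \<psi>"
    by (simp add: L1_norm_def)
  finally have 1: "norm (integral {a..b} (\<lambda>x. U x * \<psi> x)) \<le> K * L1_norm {a..b} \<psi>" .
  have "K \<ge> 0" using K[of a] \<open>a < b\<close> by simp
  then have 2: "norm (U b * \<phi> b) \<le> K * Linf_norm {a..b} \<phi>"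
    unfolding norm_mult using \<open>a < b\<close> K[of b]
    by (intro mult_mono norm_le_Linf_norm c\<phi>) (auto simp: U_def)
  show ?thesis
    unfolding eq amplitude_norm_def \<psi>_def[symmetric]
    using norm_triangle_ineq4[of "U b * \<phi> b"] 1 2
    by (smt (verit, best) distrib_left)
qed

section \<open>A Landau-Kolmogorov inequality\<close>

text \<open>The induction step takes such points in the two outer thirds of the interval, which are at
  distance at least \<open>(b - a) / 3\<close>, and applies the mean value theorem between them.\<close>

lemma higher_derivative_le_somewhere:
  fixes G :: "nat \<Rightarrow> real \<Rightarrow> real"
  assumes "a < b"
    and "\<And>i x. i < n \<Longrightarrow> x \<in> {a..b} \<Longrightarrow> (G i has_real_derivative G (Suc i) x) (at x within {a..b})"
    and "\<And>x. x \<in> {a..b} \<Longrightarrow> \<bar>G 0 x\<bar> \<le> N"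
  shows "\<exists>\<xi>\<in>{a..b}. \<bar>G n \<xi>\<bar> \<le> (\<Prod>i=1..n. 2 * 3 ^ i) * N / (b - a) ^ n"
  using assms
proof (induction n arbitrary: a b)
  case 0
  then show ?case by (auto intro!: bexI[of _ a])
next
  case (Suc n)
  define l where "l = (b - a) / 3"
  define M where "M = (\<Prod>i=1..n. 2 * 3 ^ i) * N / l ^ n"
  have l: "l > 0" and b: "b = a + 3 * l" using Suc.prems(1) by (simp_all add: l_def field_simps)
  have sub: "\<exists>\<xi>\<in>{c..c+l}. \<bar>G n \<xi>\<bar> \<le> M" if "c \<ge> a" "c + l \<le> b" for c
  proof -
    have "\<exists>\<xi>\<in>{c..c+l}. \<bar>G n \<xi>\<bar> \<le> (\<Prod>i=1..n. 2 * 3 ^ i) * N / (c + l - c) ^ n"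
    proof (rule Suc.IH)
      show "(G i has_real_derivative G (Suc i) x) (at x within {c..c+l})" if "i < n" "x \<in> {c..c+l}" for i x
        by (rule DERIV_subset[OF Suc.prems(2)]) (use that \<open>c \<ge> a\<close> \<open>c + l \<le> b\<close> in auto)
    qed (use l that Suc.prems(3) in auto)
    then show ?thesis by (simp add: M_def)
  qed
  obtain u where u: "u \<in> {a..a+l}" "\<bar>G n u\<bar> \<le> M" using sub[of a] l b by auto
  obtain v where v: "v \<in> {a+2*l..a+3*l}" "\<bar>G n v\<bar> \<le> M" using sub[of "a+2*l"] l b by (auto simp: algebra_simps)
  have uv: "u < v" "l \<le> v - u" using u v l by auto
  have "\<exists>\<xi>\<in>{u<..<v}. G n v - G n u = G (Suc n) \<xi> * (v - u)"
  proof (rule mvt_simple[OF uv(1)])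
    show "(G n has_derivative (*) (G (Suc n) x)) (at x within {u..v})" if "u \<le> x" "x \<le> v" for x
      using Suc.prems(2)[of n x] that u v b
      by (auto simp: has_field_derivative_def intro: has_derivative_subset)
  qed
  then obtain \<xi> where \<xi>: "\<xi> \<in> {u<..<v}" "G n v - G n u = G (Suc n) \<xi> * (v - u)" by blast
  have "\<bar>G (Suc n) \<xi>\<bar> * l \<le> \<bar>G (Suc n) \<xi>\<bar> * (v - u)"
    using uv by (intro mult_left_mono) auto
  also have "\<dots> = \<bar>G n v - G n u\<bar>" using \<xi>(2) uv by (simp add: abs_mult)
  also have "\<dots> \<le> 2 * M" using u v by linarith
  finally have "\<bar>G (Suc n) \<xi>\<bar> \<le> 2 * M / l" using l by (simp add: field_simps)
  \<comment> \<open>The new factor is 2 from the difference of two values and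
    \<open>3 ^ Suc n\<close> from replacing \<open>l\<close> by \<open>(b - a) / 3\<close> in
    \<open>l ^ Suc n\<close>.\<close>
  also have "\<dots> = (\<Prod>i=1..Suc n. 2 * 3 ^ i) * N / (b - a) ^ Suc n"
    using l by (simp add: M_def b power_mult_distrib field_simps)
  finally show ?case using \<xi>(1) u v b by (intro bexI[of _ \<xi>]) auto
qed

text \<open>The products are the constants of \<open>higher_derivative_le_somewhere\<close>. The
  term with \<open>A\<close> bounds the top order \<open>n\<close>; descending from there to order
  \<open>i\<close> adds one product for each order passed.\<close>

definition landau_const :: "real \<Rightarrow> nat \<Rightarrow> nat \<Rightarrow> real" where
  "landau_const A n i = (\<Sum>j=i..<n. \<Prod>m=1..j. 2 * 3 ^ m) + A * (\<Prod>m=1..n. 2 * 3 ^ m)"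

text \<open>Each derivative is small at some point. At the top order, comparability spreads this to
  the whole interval with a factor \<open>A\<close>. At a lower order, the bound already found for
  the next derivative limits the variation away from that point, so the induction runs
  downwards.\<close>

lemma derivatives_le_of_comparable_top:
  fixes G :: "nat \<Rightarrow> real \<Rightarrow> real"
  assumes "a < b"
    and deriv: "\<And>i x. i < n \<Longrightarrow> x \<in> {a..b} \<Longrightarrow> (G i has_real_derivative G (Suc i) x) (at x within {a..b})"
    and N: "\<And>x. x \<in> {a..b} \<Longrightarrow> \<bar>G 0 x\<bar> \<le> N"
    and top: "\<And>x y. x \<in> {a..b} \<Longrightarrow> y \<in> {a..b} \<Longrightarrow> \<bar>G n x\<bar> \<le> A * \<bar>G n y\<bar>" and "A \<ge> 0"
    and "i \<le> n" "x \<in> {a..b}"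
  shows "\<bar>G i x\<bar> \<le> landau_const A n i * N / (b - a) ^ i"
  unfolding landau_const_def using \<open>i \<le> n\<close> \<open>x \<in> {a..b}\<close>
proof (induction i arbitrary: x rule: inc_induct)
  case base
  obtain \<xi> where \<xi>: "\<xi> \<in> {a..b}" "\<bar>G n \<xi>\<bar> \<le> (\<Prod>i=1..n. 2 * 3 ^ i) * N / (b - a) ^ n"
    using higher_derivative_le_somewhere[OF \<open>a < b\<close> deriv N] by blast
  have "\<bar>G n x\<bar> \<le> A * \<bar>G n \<xi>\<bar>" by (rule top) (use base \<xi> in auto)
  also have "\<dots> \<le> A * ((\<Prod>i=1..n. 2 * 3 ^ i) * N / (b - a) ^ n)"
    using \<xi>(2) \<open>A \<ge> 0\<close> by (rule mult_left_mono)
  finally show ?case by simp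
next
  case (step k)
  define c where "c = (\<lambda>j. \<Prod>m=1..j. 2 * 3 ^ m :: real)"
  define D where "D = (\<Sum>j=Suc k..<n. c j) + A * c n"
  \<comment> \<open>The induction hypothesis bounds an absolute value by this quantity, which
    settles its sign.\<close>
  have D0: "0 \<le> D * N / (b - a) ^ Suc k"
    using step.IH[OF step.prems] unfolding c_def D_def by linarith
  obtain \<xi> where \<xi>: "\<xi> \<in> {a..b}" "\<bar>G k \<xi>\<bar> \<le> c k * N / (b - a) ^ k"
    unfolding c_def using higher_derivative_le_somewhere[OF \<open>a < b\<close>, of k G N] deriv N step.hyps
    by auto
  have "norm (G k x - G k \<xi>) \<le> (D * N / (b - a) ^ Suc k) * norm (x - \<xi>)"
    by (rule field_differentiable_bound[of "{a..b}" "G k" "G (Suc k)"])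
      (use step deriv \<xi> in \<open>auto simp: c_def D_def\<close>)
  also have "\<dots> \<le> (D * N / (b - a) ^ Suc k) * (b - a)"
    using step.prems \<xi>(1) D0 by (intro mult_left_mono) auto
  also have "\<dots> = D * N / (b - a) ^ k" using \<open>a < b\<close> by (simp add: field_simps)
  finally have "\<bar>G k x\<bar> \<le> D * N / (b - a) ^ k + c k * N / (b - a) ^ k"
    using \<xi>(2) by simp
  also have "\<dots> = ((\<Sum>j=k..<n. c j) + A * c n) * N / (b - a) ^ k"
    using step.hyps by (simp add: D_def sum.atLeast_Suc_lessThan add_divide_distrib algebra_simps)
  finally show ?case by (simp add: c_def)
qed

section \<open>Level crossings and balance points of continuous functions\<close>

text \<open>Take \<open>t\<close> as the first point at the upper level and \<open>s\<close> as the
  last point before \<open>t\<close> at the lower one. The upper bound then holds from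
  \<open>p\<close> on, not only from \<open>s\<close>, so that it can later be joined to a flat
  interval ending at \<open>p\<close>.\<close>

lemma continuous_crossing:
  fixes w :: "real \<Rightarrow> real"
  assumes "p \<le> q" and w: "continuous_on {p..q} w" and "w p \<le> \<alpha>" "\<alpha> < \<beta>" "\<beta> \<le> w q"
  shows "\<exists>s t. p \<le> s \<and> s < t \<and> t \<le> q \<and> w s = \<alpha> \<and> w t = \<beta> \<and>
    (\<forall>x\<in>{p..t}. w x \<le> \<beta>) \<and> (\<forall>x\<in>{s..t}. \<alpha> \<le> w x)"
proof -
  define T where "T = {x \<in> {p..q}. w x = \<beta>}"
  have "T \<noteq> {}"
    using IVT'[of w p \<beta> q] assms by (auto simp: T_def)
  moreover have "compact T"
  proof -
    have "closed T" unfolding T_def by (intro continuous_closed_preimage_constant w closed_atLeastAtMost)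
    moreover have "{p..q} \<inter> T = T" by (auto simp: T_def)
    ultimately show ?thesis using compact_Int_closed[OF compact_Icc, of T p q] by simp
  qed
  ultimately obtain t where t: "t \<in> T" "\<And>x. x \<in> T \<Longrightarrow> t \<le> x"
    using compact_attains_inf[of T] by metis
  have le: "w x \<le> \<beta>" if "x \<in> {p..t}" for x
  proof (rule ccontr)
    assume *: "\<not> w x \<le> \<beta>"
    have "continuous_on {p..x} w"
      by (rule continuous_on_subset[OF w]) (use that t in \<open>auto simp: T_def\<close>)
    then obtain y where "y \<in> {p..x}" "w y = \<beta>"
      using IVT'[of w p \<beta> x] * assms \<open>x \<in> {p..t}\<close> by auto
    moreover have "y \<noteq> x" using * \<open>w y = \<beta>\<close> by auto
    ultimately show False using t(2)[of y] that t(1) by (auto simp: T_def)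
  qed
  have tq: "p \<le> t" "t \<le> q" "w t = \<beta>" using t(1) by (auto simp: T_def)
  have wt: "continuous_on {p..t} w"
    by (rule continuous_on_subset[OF w]) (use tq in auto)
  define S where "S = {x \<in> {p..t}. w x = \<alpha>}"
  have "S \<noteq> {}"
    using IVT'[of w p \<alpha> t] assms wt tq by (auto simp: S_def)
  moreover have "compact S"
  proof -
    have "closed S" unfolding S_def by (intro continuous_closed_preimage_constant wt closed_atLeastAtMost)
    moreover have "{p..t} \<inter> S = S" by (auto simp: S_def)
    ultimately show ?thesis using compact_Int_closed[OF compact_Icc, of S p t] by simp
  qed
  ultimately obtain s where s: "s \<in> S" "\<And>x. x \<in> S \<Longrightarrow> x \<le> s"
    using compact_attains_sup[of S] by metis
  have st: "p \<le> s" "s \<le> t" "w s = \<alpha>" using s(1) by (auto simp: S_def)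
  have ge: "\<alpha> \<le> w x" if "x \<in> {s..t}" for x
  proof (rule ccontr)
    assume *: "\<not> \<alpha> \<le> w x"
    have "continuous_on {x..t} w"
      by (rule continuous_on_subset[OF wt]) (use that st in auto)
    then obtain y where "y \<in> {x..t}" "w y = \<alpha>"
      using IVT'[of w x \<alpha> t] * assms \<open>x \<in> {s..t}\<close> tq by auto
    moreover have "y \<noteq> x" using * \<open>w y = \<alpha>\<close> by auto
    ultimately show False using s(2)[of y] that st by (auto simp: S_def)
  qed
  have "s \<noteq> t" using st tq \<open>\<alpha> < \<beta>\<close> by auto
  then show ?thesis using st tq le ge by (intro exI[of _ s] exI[of _ t]) auto
qed

text \<open>The function \<open>(p - c) * w p\<close> is continuous and starts at 0. Where it equals
  1, the value of \<open>w\<close> is the reciprocal of the length already passed, and monotonicity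
  separates flat from steep there. If its value at \<open>d\<close> is at most 1, the whole interval
  is flat.\<close>

lemma mono_balance_point:
  fixes w :: "real \<Rightarrow> real"
  assumes "c < d" and w: "continuous_on {c..d} w" and nonneg: "\<And>x. x \<in> {c..d} \<Longrightarrow> 0 \<le> w x"
    and mono: "\<And>x y. c \<le> x \<Longrightarrow> x \<le> y \<Longrightarrow> y \<le> d \<Longrightarrow> w x \<le> w y"
  shows "\<exists>p. c < p \<and> p \<le> d \<and> (\<forall>x\<in>{c..p}. w x \<le> 1 / (p - c)) \<and>
    (p < d \<longrightarrow> (\<forall>x\<in>{p..d}. 1 / (p - c) \<le> w x))"
proof (cases "(d - c) * w d \<le> 1")
  case True
  have "w x \<le> 1 / (d - c)" if "x \<in> {c..d}" for x
  proof -
    have "w x \<le> w d" using mono that by auto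
    also have "\<dots> \<le> 1 / (d - c)" using True \<open>c < d\<close> by (simp add: field_simps)
    finally show ?thesis .
  qed
  then show ?thesis using \<open>c < d\<close> by (intro exI[of _ d]) auto
next
  case False
  have "continuous_on {c..d} (\<lambda>p. (p - c) * w p)"
    by (intro continuous_intros w)
  then obtain p where p: "c \<le> p" "p \<le> d" "(p - c) * w p = 1"
    using IVT'[of "\<lambda>p. (p - c) * w p" c 1 d] False \<open>c < d\<close> by auto
  then have "c < p" by (cases "c = p") auto
  then have wp: "w p = 1 / (p - c)" using p by (simp add: field_simps)
  have "\<forall>x\<in>{c..p}. w x \<le> w p" "\<forall>x\<in>{p..d}. w p \<le> w x" using mono p by auto
  then show ?thesis unfolding wp using \<open>c < p\<close> p by blast
qed

section \<open>Van der Corput's integration by parts\<close>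

text \<open>Zeros are allowed, so two closed pieces that meet at a sign change both qualify.\<close>

definition constant_sign_on :: "real set \<Rightarrow> (real \<Rightarrow> real) \<Rightarrow> bool" where
  "constant_sign_on S g \<longleftrightarrow> (\<forall>x\<in>S. 0 \<le> g x) \<or> (\<forall>x\<in>S. g x \<le> 0)"

lemma norm_oscillatory_integral_le_length:
  fixes f :: "real \<Rightarrow> real"
  assumes "continuous_on {c..d} f" "c \<le> d"
  shows "norm (integral {c..d} (\<lambda>x. exp (\<i> * of_real (f x)))) \<le> d - c"
proof -
  have "(\<lambda>x. exp (\<i> * complex_of_real (f x))) integrable_on {c..d}"
    by (intro integrable_continuous_interval continuous_intros assms)
  then have "norm (integral {c..d} (\<lambda>x. exp (\<i> * complex_of_real (f x)))) \<le> integral {c..d} (\<lambda>_. 1)"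
    by (rule Henstock_Kurzweil_Integration.integral_norm_bound_integral) auto
  then show ?thesis using \<open>c \<le> d\<close> by simp
qed

lemma norm_oscillatory_integral_le_by_parts:
  fixes f g h :: "real \<Rightarrow> real"
  assumes "c \<le> d"
    and f: "\<And>x. x \<in> {c..d} \<Longrightarrow> (f has_real_derivative g x) (at x within {c..d})"
    and g: "\<And>x. x \<in> {c..d} \<Longrightarrow> (g has_real_derivative h x) (at x within {c..d})"
    and h: "continuous_on {c..d} h"
    and "\<mu> > 0" and \<mu>: "\<And>x. x \<in> {c..d} \<Longrightarrow> \<mu> \<le> \<bar>g x\<bar>"
  shows "norm (integral {c..d} (\<lambda>x. exp (\<i> * of_real (f x)))) \<le> 2 / \<mu> + integral {c..d} (\<lambda>x. \<bar>h x\<bar> / (g x)\<^sup>2)"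
proof -
  define E where "E = (\<lambda>x. exp (\<i> * complex_of_real (f x)))"
  have nz: "g x \<noteq> 0" if "x \<in> {c..d}" for x using \<mu>[OF that] \<open>\<mu> > 0\<close> by auto
  have cf: "continuous_on {c..d} f" and cg: "continuous_on {c..d} g"
    using f g by (blast intro: DERIV_continuous_on)+
  have nE: "norm (E x) = 1" for x by (simp add: E_def)
  have cE: "continuous_on {c..d} E" unfolding E_def by (intro continuous_intros cf)
  have E': "(E has_vector_derivative \<i> * of_real (g x) * E x) (at x within {c..d})" if "x \<in> {c..d}" for x
  proof -
    have "((\<lambda>x. \<i> * complex_of_real (f x)) has_vector_derivative \<i> * of_real (g x)) (at x within {c..d})"
      by (intro has_vector_derivative_mult_right has_vector_derivative_of_real)
        (use f[OF that] in \<open>simp add: has_real_derivative_iff_has_vector_derivative\<close>)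
    from field_vector_diff_chain_within[OF this DERIV_subset[OF DERIV_exp subset_UNIV]]
    show ?thesis by (simp add: E_def o_def)
  qed
  have inv': "((\<lambda>x. complex_of_real (1 / g x)) has_vector_derivative of_real (- h x / (g x)\<^sup>2)) (at x within {c..d})"
    if "x \<in> {c..d}" for x
  proof -
    have "((\<lambda>x. 1 / g x) has_real_derivative - h x / (g x)\<^sup>2) (at x within {c..d})"
      by (rule derivative_eq_intros g[OF that] refl nz[OF that])+
        (use nz[OF that] in \<open>simp add: field_simps power2_eq_square\<close>)
    then show ?thesis
      by (intro has_vector_derivative_of_real) (simp add: has_real_derivative_iff_has_vector_derivative)
  qed
  \<comment> \<open>Since \<open>E' = i g E\<close>, the derivative of \<open>E / g\<close> is
    \<open>i E - E h / g^2\<close>. Integrating it isolates the integral of \<open>E\<close>, and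
    each boundary value of \<open>Q\<close> has norm at most \<open>1 / \<mu>\<close>.\<close>
  define Q where "Q = (\<lambda>x. E x * of_real (1 / g x))"
  have "((\<lambda>x. E x * of_real (- h x / (g x)\<^sup>2) + \<i> * of_real (g x) * E x * of_real (1 / g x))
      has_integral (Q d - Q c)) {c..d}"
    unfolding Q_def using \<open>c \<le> d\<close>
    by (intro fundamental_theorem_of_calculus has_vector_derivative_mult E' inv')
  then have "((\<lambda>x. \<i> * E x - E x * of_real (h x / (g x)\<^sup>2)) has_integral (Q d - Q c)) {c..d}"
    by (rule has_integral_eq[rotated]) (use nz in \<open>simp add: field_simps\<close>)
  moreover have intR: "(\<lambda>x. E x * of_real (h x / (g x)\<^sup>2)) integrable_on {c..d}"
    by (intro integrable_continuous_interval continuous_intros cE cg h) (use nz in auto)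
  moreover have "(\<lambda>x. \<i> * E x) integrable_on {c..d}"
    by (intro integrable_continuous_interval continuous_intros cE)
  ultimately have "\<i> * integral {c..d} E = Q d - Q c + integral {c..d} (\<lambda>x. E x * of_real (h x / (g x)\<^sup>2))"
    using integral_diff[of "\<lambda>x. \<i> * E x" "{c..d}" "\<lambda>x. E x * of_real (h x / (g x)\<^sup>2)"]
    by (simp add: integral_unique)
  then have "norm (integral {c..d} E) = norm (Q d - Q c + integral {c..d} (\<lambda>x. E x * of_real (h x / (g x)\<^sup>2)))"
    by (metis norm_mult norm_ii mult_1)
  also have "\<dots> \<le> norm (Q d) + norm (Q c) + norm (integral {c..d} (\<lambda>x. E x * of_real (h x / (g x)\<^sup>2)))"
    by (meson add_right_mono norm_triangle_ineq norm_triangle_ineq4 order_trans)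
  also have "norm (integral {c..d} (\<lambda>x. E x * of_real (h x / (g x)\<^sup>2))) \<le> integral {c..d} (\<lambda>x. \<bar>h x\<bar> / (g x)\<^sup>2)"
    by (intro Henstock_Kurzweil_Integration.integral_norm_bound_integral intR integrable_continuous_interval
        continuous_intros cg h) (use nz in \<open>auto simp: norm_mult nE norm_divide norm_power\<close>)
  also have Q: "norm (Q x) \<le> 1 / \<mu>" if "x \<in> {c..d}" for x
    using \<mu>[OF that] \<open>\<mu> > 0\<close> by (simp add: Q_def norm_mult nE norm_divide frac_le)
  finally show ?thesis
    using Q[of c] Q[of d] \<open>c \<le> d\<close> unfolding E_def by simp
qed

lemma has_integral_deriv_div_square:
  fixes g h :: "real \<Rightarrow> real"
  assumes "c \<le> d"
    and g: "\<And>x. x \<in> {c..d} \<Longrightarrow> (g has_real_derivative h x) (at x within {c..d})"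
    and nz: "\<And>x. x \<in> {c..d} \<Longrightarrow> g x \<noteq> 0"
  shows "((\<lambda>x. h x / (g x)\<^sup>2) has_integral (1 / g c - 1 / g d)) {c..d}"
proof -
  have "((\<lambda>x. - 1 / g x) has_real_derivative h x / (g x)\<^sup>2) (at x within {c..d})" if "x \<in> {c..d}" for x
    by (rule derivative_eq_intros g[OF that] refl nz[OF that])+
      (use nz[OF that] in \<open>simp add: field_simps power2_eq_square\<close>)
  then have "((\<lambda>x. h x / (g x)\<^sup>2) has_integral (- 1 / g d - - 1 / g c)) {c..d}"
    using \<open>c \<le> d\<close> by (intro fundamental_theorem_of_calculus)
      (auto simp: has_real_derivative_iff_has_vector_derivative)
  then show ?thesis by (simp add: algebra_simps)
qed

text \<open>With \<open>h\<close> of one sign, \<open>1 / g\<close> is monotone and its total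
  variation is the difference of its end values. The sign is asked for in the open interval only,
  because monotonicity of \<open>g\<close> on an arbitrary interval yields it only in the
  interior.\<close>

lemma has_integral_abs_deriv_div_square:
  fixes g h :: "real \<Rightarrow> real"
  assumes "c \<le> d"
    and g: "\<And>x. x \<in> {c..d} \<Longrightarrow> (g has_real_derivative h x) (at x within {c..d})"
    and nz: "\<And>x. x \<in> {c..d} \<Longrightarrow> g x \<noteq> 0"
    and sgn: "(\<forall>x\<in>{c<..<d}. 0 \<le> h x) \<or> (\<forall>x\<in>{c<..<d}. h x \<le> 0)"
  shows "((\<lambda>x. \<bar>h x\<bar> / (g x)\<^sup>2) has_integral \<bar>1 / g c - 1 / g d\<bar>) {c..d}"
proof -
  note 1 = has_integral_deriv_div_square[OF \<open>c \<le> d\<close> g nz]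
  define \<sigma> :: real where "\<sigma> = (if \<forall>x\<in>{c<..<d}. 0 \<le> h x then 1 else -1)"
  have "((\<lambda>x. \<sigma> * (h x / (g x)\<^sup>2)) has_integral (\<sigma> * (1 / g c - 1 / g d))) {c..d}"
    by (rule has_integral_mult_right[OF 1])
  then have 2: "((\<lambda>x. \<bar>h x\<bar> / (g x)\<^sup>2) has_integral (\<sigma> * (1 / g c - 1 / g d))) {c..d}"
  \<comment> \<open>The two endpoints, where the sign of \<open>h\<close> is unknown, form a
    negligible set.\<close>
  proof (rule has_integral_spike_finite[rotated 2])
    show "\<bar>h x\<bar> / (g x)\<^sup>2 = \<sigma> * (h x / (g x)\<^sup>2)" if "x \<in> {c..d} - {c, d}" for x
    proof -
      have "x \<in> {c<..<d}" using that by auto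
      then show ?thesis using sgn by (auto simp: \<sigma>_def)
    qed
  qed simp
  have "0 \<le> \<sigma> * (1 / g c - 1 / g d)"
    by (rule has_integral_nonneg[OF 2]) simp
  then have "\<sigma> * (1 / g c - 1 / g d) = \<bar>1 / g c - 1 / g d\<bar>"
    by (auto simp: \<sigma>_def split: if_splits)
  with 2 show ?thesis by simp
qed

lemma abs_inverse_diff_le:
  fixes u v \<mu> :: real
  assumes "\<mu> > 0" "\<mu> \<le> \<bar>u\<bar>" "\<mu> \<le> \<bar>v\<bar>"
  shows "\<bar>1 / u - 1 / v\<bar> \<le> 2 / \<mu>"
proof -
  have "\<bar>1 / u\<bar> \<le> 1 / \<mu>" "\<bar>1 / v\<bar> \<le> 1 / \<mu>"
    using assms by (auto simp: abs_divide intro!: frac_le)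
  then show ?thesis by linarith
qed

text \<open>The integrand can be discontinuous at zeros of the first derivative, so the argument is
  measurability together with the bound 1.\<close>

lemma curvature_min_integrable:
  assumes f: "cont_diff_on 2 {a..b} f"
  shows "curvature_min a b f integrable_on {a..b}"
proof -
  have "continuous_on {a..b} (higher_deriv_on 1 {a..b} f)" "continuous_on {a..b} (higher_deriv_on 2 {a..b} f)"
    using cont_diff_on_imp_continuous_on[OF f] by auto
  then have [measurable]: "deriv_on {a..b} f \<in> borel_measurable (lebesgue_on {a..b})"
     "higher_deriv_on 2 {a..b} f \<in> borel_measurable (lebesgue_on {a..b})"
    by (auto intro!: continuous_imp_measurable_on_sets_lebesgue simp: higher_deriv_on_def)
  have "curvature_min a b f \<in> borel_measurable (lebesgue_on {a..b})"
    unfolding curvature_min_def[abs_def] by measurable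
  then show ?thesis
    by (rule measurable_bounded_by_integrable_imp_integrable[where g = "\<lambda>_. 1"])
      (auto simp: curvature_min_def)
qed

section \<open>Flat intervals\<close>

lemma abs_deriv_on_le_SUP:
  fixes f :: "real \<Rightarrow> real"
  assumes "cont_diff_on 2 {a..b} f" "x \<in> {a..b}"
  shows "\<bar>deriv_on {a..b} f x\<bar> \<le> (SUP x\<in>{a..b}. \<bar>deriv_on {a..b} f x\<bar>)"
proof (rule cSUP_upper[OF assms(2), where f = "\<lambda>x. \<bar>deriv_on {a..b} f x\<bar>"])
  have "continuous_on {a..b} (deriv_on {a..b} f)"
    using cont_diff_on_imp_continuous_on[OF assms(1), of 1] by (simp add: higher_deriv_on_def)
  then have "compact ((\<lambda>x. \<bar>deriv_on {a..b} f x\<bar>) ` {a..b})"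
    by (intro compact_continuous_image continuous_intros compact_Icc)
  then show "bdd_above ((\<lambda>x. \<bar>deriv_on {a..b} f x\<bar>) ` {a..b})"
    by (rule bounded_imp_bdd_above[OF compact_imp_bounded])
qed

lemma integral_curvature_min_nonneg:
  assumes "cont_diff_on 2 {a..b} f"
  shows "0 \<le> integral {a..b} (curvature_min a b f)"
  by (rule integral_nonneg[OF curvature_min_integrable[OF assms]]) (auto simp: curvature_min_def)

lemma phase_bound_ge:
  assumes "a \<le> b" "cont_diff_on 2 {a..b} f"
  shows "integral {a..b} (curvature_min a b f) \<le> phase_bound a b f"
    and "min (b - a) (1 / (SUP x\<in>{a..b}. \<bar>deriv_on {a..b} f x\<bar>)) \<le> phase_bound a b f"
proof -
  have "0 \<le> (SUP x\<in>{a..b}. \<bar>deriv_on {a..b} f x\<bar>)"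
    using abs_deriv_on_le_SUP[OF assms(2), of a] assms(1) by (smt (verit) atLeastAtMost_iff)
  then show "integral {a..b} (curvature_min a b f) \<le> phase_bound a b f"
    using assms(1) by (simp add: phase_bound_def)
  show "min (b - a) (1 / (SUP x\<in>{a..b}. \<bar>deriv_on {a..b} f x\<bar>)) \<le> phase_bound a b f"
    using integral_curvature_min_nonneg[OF assms(2)] by (simp add: phase_bound_def)
qed

text \<open>Between \<open>s\<close> and \<open>t\<close> the size of \<open>1 / f'\<close> changes
  by \<open>r / 2\<close>, and this change is the integral of \<open>f'' / f'^2\<close>. The
  Landau-Kolmogorov bound makes that ratio at most \<open>2 * C\<close> there, so truncating it at 1
  loses only a constant factor.\<close>

lemma crossing_length_le_integral_curvature_min:
  fixes f :: "real \<Rightarrow> real"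
  assumes "2 \<le> k" and f: "cont_diff_on k {a..b} f" and "A \<ge> 0"
    and top: "\<And>x y. x \<in> {a..b} \<Longrightarrow> y \<in> {a..b} \<Longrightarrow>
      \<bar>higher_deriv_on k {a..b} f x\<bar> \<le> A * \<bar>higher_deriv_on k {a..b} f y\<bar>"
    and r: "0 < r" "r \<le> d - c" and cd: "{c..d} \<subseteq> {a..b}"
    and ub: "\<And>x. x \<in> {c..d} \<Longrightarrow> \<bar>deriv_on {a..b} f x\<bar> \<le> 2 / r"
    and st: "s \<le> t" "{s..t} \<subseteq> {c..d}"
    and lb: "\<And>x. x \<in> {s..t} \<Longrightarrow> 1 / r \<le> \<bar>deriv_on {a..b} f x\<bar>"
    and ends: "{\<bar>deriv_on {a..b} f s\<bar>, \<bar>deriv_on {a..b} f t\<bar>} = {1 / r, 2 / r}"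
  shows "r \<le> 4 * max 1 (landau_const A (k - 1) 1) * integral {a..b} (curvature_min a b f)"
proof -
  define C where "C = max 1 (landau_const A (k - 1) 1)"
  define g where "g = deriv_on {a..b} f"
  define h where "h = higher_deriv_on 2 {a..b} f"
  define G where "G = (\<lambda>i. higher_deriv_on (Suc i) {a..b} f)"
  have G: "G 0 = g" "G (Suc 0) = h" by (simp_all add: G_def g_def h_def higher_deriv_on_def numeral_2_eq_2)
  have k: "Suc (k - 1) = k" using \<open>2 \<le> k\<close> by simp
  have G': "(G i has_real_derivative G (Suc i) x) (at x within S)" if "i < k - 1" "x \<in> S" "S \<subseteq> {a..b}" for i x S
    unfolding G_def
    by (rule DERIV_subset[OF has_real_derivative_higher_deriv_on[OF f]]) (use that in auto)
  have g': "(g has_real_derivative h x) (at x within S)" if "x \<in> S" "S \<subseteq> {a..b}" for x S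
    using G'[of 0 x S] that \<open>2 \<le> k\<close> by (simp add: G)
  have f2: "cont_diff_on 2 {a..b} f"
    using f \<open>2 \<le> k\<close> by (rule cont_diff_on_two)
  have "c < d" using r by simp
  have h: "\<bar>h x\<bar> \<le> C * (2 / r\<^sup>2)" if "x \<in> {c..d}" for x
  proof -
    \<comment> \<open>The inequality is applied to \<open>f'\<close>, for which the comparable
      derivative has order \<open>k - 1\<close>. Afterwards \<open>r <= d - c\<close> replaces the
      length by \<open>r\<close>.\<close>
    have "\<bar>G 1 x\<bar> \<le> landau_const A (k - 1) 1 * (2 / r) / (d - c) ^ 1"
    proof (rule derivatives_le_of_comparable_top[OF \<open>c < d\<close>, where n = "k - 1" and G = G and A = A and N = "2 / r"])
      show "(G i has_real_derivative G (Suc i) x) (at x within {c..d})" if "i < k - 1" "x \<in> {c..d}" for i x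
        using G' that cd by blast
      show "\<bar>G (k - 1) x\<bar> \<le> A * \<bar>G (k - 1) y\<bar>" if "x \<in> {c..d}" "y \<in> {c..d}" for x y
        unfolding G_def k using top that cd by blast
    qed (use that \<open>A \<ge> 0\<close> \<open>2 \<le> k\<close> ub in \<open>auto simp: G g_def\<close>)
    also have "\<dots> \<le> C * (2 / r) / r"
      using r by (intro frac_le mult_right_mono) (auto simp: C_def)
    finally show ?thesis by (simp add: G power2_eq_square)
  qed
  have nz: "g x \<noteq> 0" if "x \<in> {s..t}" for x
    using lb[OF that] r by (auto simp: g_def)
  have cm: "\<bar>h x / (g x)\<^sup>2\<bar> \<le> 2 * C * curvature_min a b f x" if x: "x \<in> {s..t}" for x
  proof -
    have "(1 / r)\<^sup>2 \<le> \<bar>g x\<bar>\<^sup>2" using lb[OF x] r by (intro power_mono) (auto simp: g_def)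
    then have "\<bar>h x / (g x)\<^sup>2\<bar> \<le> C * (2 / r\<^sup>2) / (1 / r)\<^sup>2"
      unfolding abs_divide using h[of x] x st r by (intro frac_le) (auto simp: C_def)
    also have "\<dots> = 2 * C" using r by (simp add: field_simps)
    finally have "\<bar>h x / (g x)\<^sup>2\<bar> \<le> 2 * C" .
    \<comment> \<open>A quantity that is at most \<open>2 * C\<close> and at most
      \<open>2 * C\<close> times itself is at most \<open>2 * C\<close> times its minimum with
      1.\<close>
    moreover have "1 * \<bar>h x / (g x)\<^sup>2\<bar> \<le> (2 * C) * \<bar>h x / (g x)\<^sup>2\<bar>"
      by (rule mult_right_mono) (auto simp: C_def)
    moreover have "curvature_min a b f x = min 1 \<bar>h x / (g x)\<^sup>2\<bar>"
      using nz[OF x] by (simp add: curvature_min_def g_def h_def)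
    ultimately show ?thesis by (auto simp: min_def)
  qed
  have sub: "{s..t} \<subseteq> {a..b}" using st cd by blast
  have int: "curvature_min a b f integrable_on {s..t}"
    using integrable_subinterval_real[OF curvature_min_integrable[OF f2] sub] .
  have hi: "((\<lambda>x. h x / (g x)\<^sup>2) has_integral (1 / g s - 1 / g t)) {s..t}"
    by (rule has_integral_deriv_div_square[OF st(1) g' nz]) (use sub in auto)
  have "\<bar>1 / g s - 1 / g t\<bar> \<le> integral {s..t} (\<lambda>x. 2 * C * curvature_min a b f x)"
    unfolding integral_unique[OF hi, symmetric] real_norm_def[symmetric]
    by (rule Henstock_Kurzweil_Integration.integral_norm_bound_integral)
      (use hi integrable_cmul[OF int, of "2 * C"] cm in \<open>auto simp: has_integral_integrable\<close>)
  also have "\<dots> = 2 * C * integral {s..t} (curvature_min a b f)" by simp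
  also have "\<dots> \<le> 2 * C * integral {a..b} (curvature_min a b f)"
    by (intro mult_left_mono integral_subset_le sub int curvature_min_integrable f2)
      (auto simp: C_def curvature_min_def)
  finally have 1: "\<bar>1 / g s - 1 / g t\<bar> \<le> 2 * C * integral {a..b} (curvature_min a b f)" .
  \<comment> \<open>The end values of \<open>1 / g\<close> have sizes \<open>r\<close> and
    \<open>r / 2\<close> in some order; \<open>ends\<close> is a set equation so that rising and
    falling crossings are treated together.\<close>
  have "\<bar>\<bar>1 / g s\<bar> - \<bar>1 / g t\<bar>\<bar> = r / 2"
    using ends r unfolding g_def[symmetric] by (auto simp: doubleton_eq_iff abs_divide)
  then have "r / 2 \<le> \<bar>1 / g s - 1 / g t\<bar>"
    using abs_triangle_ineq3[of "1 / g s" "1 / g t"] by linarith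
  then show ?thesis using 1 by (simp add: C_def)
qed

text \<open>If the supremum \<open>M\<close> of the first derivative is at most
  \<open>2 / r\<close>, a summand of \<open>phase_bound\<close> is at least \<open>r / 2\<close>
  directly. Otherwise the derivative must climb to \<open>2 / r\<close> on one side of the flat
  interval, and the crossing estimate applies to the union of the flat interval and the
  climb.\<close>

lemma flat_length_le_phase_bound:
  fixes f :: "real \<Rightarrow> real"
  assumes "a < b" "2 \<le> k" and f: "cont_diff_on k {a..b} f" and "A \<ge> 0"
    and top: "\<And>x y. x \<in> {a..b} \<Longrightarrow> y \<in> {a..b} \<Longrightarrow>
      \<bar>higher_deriv_on k {a..b} f x\<bar> \<le> A * \<bar>higher_deriv_on k {a..b} f y\<bar>"
    and uv: "a \<le> u" "u < v" "v \<le> b"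
    and flat: "\<And>x. x \<in> {u..v} \<Longrightarrow> \<bar>deriv_on {a..b} f x\<bar> \<le> 1 / (v - u)"
  shows "v - u \<le> 4 * max 1 (landau_const A (k - 1) 1) * phase_bound a b f"
proof -
  define C where "C = max 1 (landau_const A (k - 1) 1)"
  have "C \<ge> 1" by (simp add: C_def)
  define g where "g = deriv_on {a..b} f"
  define r where "r = v - u"
  define M where "M = (SUP x\<in>{a..b}. \<bar>g x\<bar>)"
  have "r > 0" using uv by (simp add: r_def)
  then have r12: "1 / r < 2 / r" by (simp add: divide_strict_right_mono)
  have f2: "cont_diff_on 2 {a..b} f"
    using f \<open>2 \<le> k\<close> by (rule cont_diff_on_two)
  have cg: "continuous_on {a..b} (\<lambda>x. \<bar>g x\<bar>)"
    using cont_diff_on_imp_continuous_on[OF f2, of 1]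
    by (intro continuous_on_rabs) (simp add: higher_deriv_on_def g_def)
  have M: "\<bar>g x\<bar> \<le> M" if "x \<in> {a..b}" for x
    using abs_deriv_on_le_SUP[OF f2 that] by (simp add: M_def g_def)
  note pb = phase_bound_ge[OF less_imp_le[OF \<open>a < b\<close>] f2, folded g_def, folded M_def]
  have C_mono: "r \<le> 4 * C * phase_bound a b f" if "r \<le> 2 * y" "y \<le> phase_bound a b f" for y
  proof -
    have "2 * phase_bound a b f \<le> 4 * C * phase_bound a b f"
      using \<open>C \<ge> 1\<close> that \<open>r > 0\<close> by (intro mult_right_mono) auto
    then show ?thesis using that by linarith
  qed
  have C_cross: "r \<le> 4 * C * phase_bound a b f" if "r \<le> 4 * C * integral {a..b} (curvature_min a b f)"
    using that pb(1) \<open>C \<ge> 1\<close> by (meson mult_left_mono order_trans zero_le_numeral mult_nonneg_nonneg zero_le_one)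
  have flat': "\<bar>g x\<bar> \<le> 1 / r" if "x \<in> {u..v}" for x using flat[OF that] by (simp add: g_def r_def)
  consider "M = 0" | "M \<noteq> 0" "M \<le> 2 / r" | x0 where "x0 \<in> {a..b}" "2 / r < \<bar>g x0\<bar>"
  proof (cases "M \<le> 2 / r")
    case False
    then have "\<exists>x0\<in>{a..b}. 2 / r < \<bar>g x0\<bar>"
      using cSUP_least[of "{a..b}" "\<lambda>x. \<bar>g x\<bar>" "2 / r"] \<open>a < b\<close> unfolding M_def by (force simp: not_less)
    then show ?thesis using that by blast
  qed (use that in blast)
  then have "r \<le> 4 * C * phase_bound a b f"
  proof cases
    \<comment> \<open>Here \<open>1 / M\<close> is 0 by the convention for division, so the second
      summand gives nothing. The curvature integrand is identically 1 instead, and its integral is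
      \<open>b - a\<close>.\<close>
    case 1
    then have "curvature_min a b f x = 1" if "x \<in> {a..b}" for x
      using M[OF that] by (simp add: curvature_min_def g_def)
    then have "integral {a..b} (curvature_min a b f) = integral {a..b} (\<lambda>x. 1)"
      by (intro Henstock_Kurzweil_Integration.integral_cong) auto
    also have "\<dots> = b - a" using \<open>a < b\<close> by simp
    finally show ?thesis using pb(1) uv \<open>r > 0\<close> by (intro C_mono[of "b - a"]) (auto simp: r_def)
  next
    case 2
    then have "M > 0" using M[of a] \<open>a < b\<close> by simp
    then have "r / 2 \<le> 1 / M" using 2 \<open>r > 0\<close> by (simp add: field_simps)
    then show ?thesis using pb(2) uv \<open>r > 0\<close>
      by (intro C_mono[of "r / 2"]) (auto simp: r_def min_def split: if_splits)
  next
    case 3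
    have out: "x0 \<notin> {u..v}" using flat'[of x0] 3 r12 by auto
    show ?thesis
    proof (cases "v < x0")
      case True
      have "continuous_on {v..x0} (\<lambda>x. \<bar>g x\<bar>)"
        by (rule continuous_on_subset[OF cg]) (use uv 3 in auto)
      then obtain s t where st: "v \<le> s" "s < t" "t \<le> x0" "\<bar>g s\<bar> = 1 / r" "\<bar>g t\<bar> = 2 / r"
          "\<forall>x\<in>{v..t}. \<bar>g x\<bar> \<le> 2 / r" "\<forall>x\<in>{s..t}. 1 / r \<le> \<bar>g x\<bar>"
        using continuous_crossing[of v x0 "\<lambda>x. \<bar>g x\<bar>" "1 / r" "2 / r"] True flat'[of v] 3 r12 uv by auto
      \<comment> \<open>The flat interval is included so that the interval for the Landau-Kolmogorov
        bound has length at least \<open>r\<close>; the climb alone may be much shorter.\<close>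
      have "\<bar>g x\<bar> \<le> 2 / r" if "x \<in> {u..t}" for x
        using that st(6) flat'[of x] r12 by (cases "x \<le> v") auto
      then show ?thesis
        unfolding C_def
        by (intro C_cross[unfolded C_def] crossing_length_le_integral_curvature_min[OF \<open>2 \<le> k\<close> f \<open>A \<ge> 0\<close> top \<open>r > 0\<close>,
            where c = u and d = t and s = s and t = t])
          (use st uv 3 in \<open>auto simp: g_def r_def\<close>)
    next
      case False
      then have "x0 < u" using out by auto
      \<comment> \<open>A climb to the left of the flat interval is found by reflection. Reflecting
        back exchanges the two ends of the crossing.\<close>
      have "continuous_on {-u..-x0} (\<lambda>x. \<bar>g (- x)\<bar>)"
        by (rule continuous_on_compose2[OF cg]) (use uv 3 in \<open>auto intro!: continuous_intros\<close>)
      then obtain s t where st: "-u \<le> s" "s < t" "t \<le> -x0" "\<bar>g (-s)\<bar> = 1 / r" "\<bar>g (-t)\<bar> = 2 / r"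
          "\<forall>x\<in>{-u..t}. \<bar>g (-x)\<bar> \<le> 2 / r" "\<forall>x\<in>{s..t}. 1 / r \<le> \<bar>g (-x)\<bar>"
        using continuous_crossing[of "-u" "-x0" "\<lambda>x. \<bar>g (-x)\<bar>" "1 / r" "2 / r"] \<open>x0 < u\<close> flat'[of u] 3 r12 uv
        by auto
      have ub: "\<bar>g x\<bar> \<le> 2 / r" if "x \<in> {-t..v}" for x
        using that st(6)[rule_format, of "-x"] flat'[of x] r12 by (cases "x \<le> u") auto
      have lb: "1 / r \<le> \<bar>g x\<bar>" if "x \<in> {-t..-s}" for x
        using st(7)[rule_format, of "-x"] that by auto
      show ?thesis
        unfolding C_def
        by (intro C_cross[unfolded C_def] crossing_length_le_integral_curvature_min[OF \<open>2 \<le> k\<close> f \<open>A \<ge> 0\<close> top \<open>r > 0\<close>,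
            where c = "-t" and d = v and s = "-t" and t = "-s"])
          (use st uv 3 ub lb in \<open>auto simp: g_def r_def\<close>)
    qed
  qed
  then show ?thesis by (simp add: r_def C_def)
qed

section \<open>Decomposition into pieces of constant sign\<close>

lemma deriv_nonneg_imp_le:
  fixes g h :: "real \<Rightarrow> real"
  assumes "\<And>x. x \<in> {c..d} \<Longrightarrow> (g has_real_derivative h x) (at x within {c..d})"
    and "\<And>x. x \<in> {c..d} \<Longrightarrow> 0 \<le> h x" and "c \<le> x" "x \<le> y" "y \<le> d"
  shows "g x \<le> g y"
proof -
  have "\<exists>z\<in>{x..y}. g y - g x = h z * (y - x)"
  proof (rule mvt_very_simple[OF \<open>x \<le> y\<close>])
    show "(g has_derivative (*) (h z)) (at z within {x..y})" if "x \<le> z" "z \<le> y" for z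
      using assms(1)[of z] that assms(3-5)
      by (auto simp: has_field_derivative_def intro: has_derivative_subset)
  qed
  then show ?thesis using assms by (smt (verit) atLeastAtMost_iff mult_nonneg_nonneg)
qed

lemma constant_sign_deriv_imp_monotone:
  fixes g h :: "real \<Rightarrow> real"
  assumes g: "\<And>x. x \<in> {c..d} \<Longrightarrow> (g has_real_derivative h x) (at x within {c..d})"
    and h: "constant_sign_on {c..d} h"
  shows "(\<forall>x y. c \<le> x \<longrightarrow> x \<le> y \<longrightarrow> y \<le> d \<longrightarrow> g x \<le> g y) \<or> (\<forall>x y. c \<le> x \<longrightarrow> x \<le> y \<longrightarrow> y \<le> d \<longrightarrow> g y \<le> g x)"
  using h unfolding constant_sign_on_def
proof
  assume "\<forall>x\<in>{c..d}. 0 \<le> h x"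
  then show ?thesis using deriv_nonneg_imp_le[OF g] by blast
next
  assume "\<forall>x\<in>{c..d}. h x \<le> 0"
  then have "- g x \<le> - g y" if "c \<le> x" "x \<le> y" "y \<le> d" for x y
    by (intro deriv_nonneg_imp_le[of c d "\<lambda>x. - g x" "\<lambda>x. - h x"] DERIV_minus g) (use that in auto)
  then show ?thesis by auto
qed

text \<open>The two signs make the size of \<open>g\<close> monotone, so a balance point separates a
  flat part of length \<open>r\<close> from a part where it is at least \<open>1 / r\<close>. The
  flat part costs \<open>r\<close> trivially and the steep part \<open>4 * r\<close>, which gives
  the factor 5.\<close>

lemma oscillatory_integral_le_flat_length:
  fixes f g h :: "real \<Rightarrow> real"
  assumes "c < d"
    and f: "\<And>x. x \<in> {c..d} \<Longrightarrow> (f has_real_derivative g x) (at x within {c..d})"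
    and g: "\<And>x. x \<in> {c..d} \<Longrightarrow> (g has_real_derivative h x) (at x within {c..d})"
    and h: "continuous_on {c..d} h"
    and sg: "constant_sign_on {c..d} g" and sh: "constant_sign_on {c..d} h"
  shows "\<exists>u v. c \<le> u \<and> u < v \<and> v \<le> d \<and> (\<forall>x\<in>{u..v}. \<bar>g x\<bar> \<le> 1 / (v - u)) \<and>
    norm (integral {c..d} (\<lambda>x. exp (\<i> * of_real (f x)))) \<le> 5 * (v - u)"
proof -
  define E where "E = (\<lambda>x. exp (\<i> * complex_of_real (f x)))"
  have cf: "continuous_on {c..d} f" and cg: "continuous_on {c..d} g"
    using f g by (blast intro: DERIV_continuous_on)+
  have intE: "E integrable_on {c..d}"
    unfolding E_def by (intro integrable_continuous_interval continuous_intros cf)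
  have triv: "norm (integral {x..y} E) \<le> y - x" if "c \<le> x" "x \<le> y" "y \<le> d" for x y
    unfolding E_def using that
    by (intro norm_oscillatory_integral_le_length continuous_on_subset[OF cf]) auto
  \<comment> \<open>The boundary terms contribute \<open>2 * r\<close>, and the variation of
    \<open>1 / g\<close> contributes at most another \<open>2 * r\<close>.\<close>
  have steep: "norm (integral {x..y} E) \<le> 4 * r"
    if "c \<le> x" "x \<le> y" "y \<le> d" "r > 0" "\<And>z. z \<in> {x..y} \<Longrightarrow> 1 / r \<le> \<bar>g z\<bar>" for x y r
  proof -
    have sub: "{x..y} \<subseteq> {c..d}" using that by auto
    have f': "(f has_real_derivative g z) (at z within {x..y})"
      and g': "(g has_real_derivative h z) (at z within {x..y})" if "z \<in> {x..y}" for z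
      using f g that sub DERIV_subset by blast+
    have nz: "g z \<noteq> 0" if "z \<in> {x..y}" for z
      using \<open>\<And>z. z \<in> {x..y} \<Longrightarrow> 1 / r \<le> \<bar>g z\<bar>\<close>[OF that] \<open>r > 0\<close> by auto
    have "norm (integral {x..y} E) \<le> 2 / (1 / r) + integral {x..y} (\<lambda>z. \<bar>h z\<bar> / (g z)\<^sup>2)"
      unfolding E_def
      by (rule norm_oscillatory_integral_le_by_parts[OF \<open>x \<le> y\<close> f' g' continuous_on_subset[OF h sub]])
        (use that in auto)
    also have "integral {x..y} (\<lambda>z. \<bar>h z\<bar> / (g z)\<^sup>2) = \<bar>1 / g x - 1 / g y\<bar>"
      by (intro integral_unique has_integral_abs_deriv_div_square[OF \<open>x \<le> y\<close> g' nz])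
        (use sh sub in \<open>auto simp: constant_sign_on_def\<close>)
    also have "\<dots> \<le> 2 / (1 / r)" by (rule abs_inverse_diff_le) (use that in auto)
    finally show ?thesis by simp
  qed
  have split: "norm (integral {c..d} E) \<le> norm (integral {c..p} E) + norm (integral {p..d} E)"
    if "c \<le> p" "p \<le> d" for p
    using Henstock_Kurzweil_Integration.integral_combine[OF that intE] norm_triangle_ineq by metis
  have mono: "(\<forall>x y. c \<le> x \<longrightarrow> x \<le> y \<longrightarrow> y \<le> d \<longrightarrow> \<bar>g x\<bar> \<le> \<bar>g y\<bar>) \<or>
      (\<forall>x y. c \<le> x \<longrightarrow> x \<le> y \<longrightarrow> y \<le> d \<longrightarrow> \<bar>g y\<bar> \<le> \<bar>g x\<bar>)"
  proof -
    have "(\<forall>x\<in>{c..d}. \<bar>g x\<bar> = g x) \<or> (\<forall>x\<in>{c..d}. \<bar>g x\<bar> = - g x)"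
      using sg by (auto simp: constant_sign_on_def)
    then show ?thesis using constant_sign_deriv_imp_monotone[OF g sh]
      by (smt (verit) atLeastAtMost_iff)
  qed
  then have "\<exists>u v. c \<le> u \<and> u < v \<and> v \<le> d \<and> (\<forall>x\<in>{u..v}. \<bar>g x\<bar> \<le> 1 / (v - u)) \<and>
    norm (integral {c..d} E) \<le> 5 * (v - u)"
  proof
    assume "\<forall>x y. c \<le> x \<longrightarrow> x \<le> y \<longrightarrow> y \<le> d \<longrightarrow> \<bar>g x\<bar> \<le> \<bar>g y\<bar>"
    then obtain p where p: "c < p" "p \<le> d" "\<forall>x\<in>{c..p}. \<bar>g x\<bar> \<le> 1 / (p - c)"
        "p < d \<longrightarrow> (\<forall>x\<in>{p..d}. 1 / (p - c) \<le> \<bar>g x\<bar>)"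
      using mono_balance_point[OF \<open>c < d\<close> continuous_on_rabs[OF cg]] by auto
    have "norm (integral {p..d} E) \<le> 4 * (p - c)"
      using steep[of p d "p - c"] p by (cases "p < d") auto
    then have "norm (integral {c..d} E) \<le> 5 * (p - c)"
      using split[of p] triv[of c p] p by auto
    then show ?thesis using p by (intro exI[of _ c] exI[of _ p]) auto
  next
    assume anti: "\<forall>x y. c \<le> x \<longrightarrow> x \<le> y \<longrightarrow> y \<le> d \<longrightarrow> \<bar>g y\<bar> \<le> \<bar>g x\<bar>"
    \<comment> \<open>When the size of \<open>g\<close> decreases, the flat part lies at the right
      end; reflection reduces this to the increasing case, with flat part \<open>{-q..d}\<close> of
      length \<open>q + d\<close>.\<close>
    have "continuous_on {-d..-c} (\<lambda>x. \<bar>g (- x)\<bar>)"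
      by (rule continuous_on_compose2[OF continuous_on_rabs[OF cg]]) (auto intro!: continuous_intros)
    then obtain q where q: "-d < q" "q \<le> -c" "\<forall>x\<in>{-d..q}. \<bar>g (-x)\<bar> \<le> 1 / (q + d)"
        "q < -c \<longrightarrow> (\<forall>x\<in>{q..-c}. 1 / (q + d) \<le> \<bar>g (-x)\<bar>)"
      using mono_balance_point[of "-d" "-c" "\<lambda>x. \<bar>g (- x)\<bar>"] anti \<open>c < d\<close> by auto
    have flat: "\<bar>g x\<bar> \<le> 1 / (q + d)" if "x \<in> {-q..d}" for x
      using q(3)[rule_format, of "-x"] that by auto
    have "norm (integral {c..-q} E) \<le> 4 * (q + d)"
    proof (cases "q < -c")
      case True
      then have "1 / (q + d) \<le> \<bar>g x\<bar>" if "x \<in> {c..-q}" for x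
        using q(4)[rule_format, of "-x"] that by auto
      then show ?thesis using steep[of c "-q" "q + d"] q by auto
    qed (use q in auto)
    then have "norm (integral {c..d} E) \<le> 5 * (q + d)"
      using split[of "-q"] triv[of "-q" d] q by auto
    then show ?thesis using q flat by (intro exI[of _ "-q"] exI[of _ d]) (auto simp: add.commute)
  qed
  then show ?thesis by (simp add: E_def)
qed

lemma continuous_nonvanishing_constant_sign:
  assumes "continuous_on {a..b} g" "\<And>x. x \<in> {a..b} \<Longrightarrow> g x \<noteq> 0"
  shows "constant_sign_on {a..b} g"
proof (rule ccontr)
  assume "\<not> ?thesis"
  then obtain x y where xy: "x \<in> {a..b}" "g x < 0" "y \<in> {a..b}" "0 < g y"
    by (auto simp: constant_sign_on_def not_le)
  have "connected (g ` {a..b})"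
    by (intro connected_continuous_image assms(1) connected_Icc)
  then have "0 \<in> g ` {a..b}"
    using connectedD_interval[of "g ` {a..b}" "g x" "g y" 0] xy by auto
  then show False using assms(2) by auto
qed

lemma monotone_constant_sign_split:
  fixes g :: "real \<Rightarrow> real"
  assumes "c \<le> d" and g: "continuous_on {c..d} g"
    and mono: "\<And>x y. c \<le> x \<Longrightarrow> x \<le> y \<Longrightarrow> y \<le> d \<Longrightarrow> g x \<le> g y"
  shows "\<exists>z\<in>{c..d}. (\<forall>x\<in>{c..z}. g x \<le> 0) \<and> (\<forall>x\<in>{z..d}. 0 \<le> g x)
    \<or> (\<forall>x\<in>{c..d}. 0 < g x) \<or> (\<forall>x\<in>{c..d}. g x < 0)"
proof (cases "g c \<le> 0 \<and> 0 \<le> g d")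
  case True
  then obtain z where z: "c \<le> z" "z \<le> d" "g z = 0" using IVT'[of g c 0 d] g \<open>c \<le> d\<close> by auto
  have "\<forall>x\<in>{c..z}. g x \<le> g z" "\<forall>x\<in>{z..d}. g z \<le> g x" using mono[of _ z] mono[of z] z by simp_all
  then show ?thesis using z by (intro bexI[of _ z]) auto
next
  case False
  have "\<forall>x\<in>{c..d}. g c \<le> g x \<and> g x \<le> g d" using mono by auto
  \<comment> \<open>One strict sign prevails on the whole interval, so any point can serve as
    \<open>z\<close>.\<close>
  then show ?thesis using False \<open>c \<le> d\<close> by (intro bexI[of _ c]) fastforce+
qed

lemma constant_sign_split:
  fixes g h :: "real \<Rightarrow> real"
  assumes "c \<le> d" and g: "\<And>x. x \<in> {c..d} \<Longrightarrow> (g has_real_derivative h x) (at x within {c..d})"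
    and h: "constant_sign_on {c..d} h"
  shows "\<exists>z\<in>{c..d}. constant_sign_on {c..z} g \<and> constant_sign_on {z..d} g"
proof -
  have cg: "continuous_on {c..d} g" using g by (blast intro: DERIV_continuous_on)
  have sub: "{c..z} \<subseteq> {c..d}" "{z..d} \<subseteq> {c..d}" if "z \<in> {c..d}" for z using that by auto
  from constant_sign_deriv_imp_monotone[OF g h] show ?thesis
  proof
    assume "\<forall>x y. c \<le> x \<longrightarrow> x \<le> y \<longrightarrow> y \<le> d \<longrightarrow> g x \<le> g y"
    then obtain z where "z \<in> {c..d}" "(\<forall>x\<in>{c..z}. g x \<le> 0) \<and> (\<forall>x\<in>{z..d}. 0 \<le> g x)
      \<or> (\<forall>x\<in>{c..d}. 0 < g x) \<or> (\<forall>x\<in>{c..d}. g x < 0)"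
      using monotone_constant_sign_split[OF \<open>c \<le> d\<close> cg] by blast
    with sub[of z] show ?thesis unfolding constant_sign_on_def
      by (intro bexI[of _ z]) (auto intro: less_imp_le)
  next
    assume "\<forall>x y. c \<le> x \<longrightarrow> x \<le> y \<longrightarrow> y \<le> d \<longrightarrow> g y \<le> g x"
    then obtain z where "z \<in> {c..d}" "(\<forall>x\<in>{c..z}. - g x \<le> 0) \<and> (\<forall>x\<in>{z..d}. 0 \<le> - g x)
      \<or> (\<forall>x\<in>{c..d}. 0 < - g x) \<or> (\<forall>x\<in>{c..d}. - g x < 0)"
      using monotone_constant_sign_split[OF \<open>c \<le> d\<close> continuous_on_minus[OF cg]] by auto
    with sub[of z] show ?thesis unfolding constant_sign_on_def
      by (intro bexI[of _ z]) (auto intro: less_imp_le)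
  qed
qed

text \<open>Here \<open>m\<close> is the lowest order from which all signs are known. Lowering it by
  one cuts the interval once, at the sign change of \<open>G m\<close>; higher orders keep their
  signs on both halves. Hence at most \<open>2 ^ m\<close> pieces arise, and subadditivity sums
  their bounds.\<close>

lemma bound_of_constant_sign_pieces:
  fixes G :: "nat \<Rightarrow> real \<Rightarrow> real" and \<Phi> :: "real \<Rightarrow> real \<Rightarrow> real"
  assumes deriv: "\<And>i x. i < k \<Longrightarrow> x \<in> {a..b} \<Longrightarrow> (G i has_real_derivative G (Suc i) x) (at x within {a..b})"
    and subadd: "\<And>c z d. a \<le> c \<Longrightarrow> c \<le> z \<Longrightarrow> z \<le> d \<Longrightarrow> d \<le> b \<Longrightarrow> \<Phi> c d \<le> \<Phi> c z + \<Phi> z d"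
    and piece: "\<And>c d. a \<le> c \<Longrightarrow> c \<le> d \<Longrightarrow> d \<le> b \<Longrightarrow> (\<And>i. i \<le> k \<Longrightarrow> constant_sign_on {c..d} (G i)) \<Longrightarrow> \<Phi> c d \<le> K"
    and "m \<le> k" "a \<le> c" "c \<le> d" "d \<le> b"
    and "\<And>i. m \<le> i \<Longrightarrow> i \<le> k \<Longrightarrow> constant_sign_on {c..d} (G i)"
  shows "\<Phi> c d \<le> 2 ^ m * K"
  using assms(4-)
proof (induction m arbitrary: c d)
  case 0
  then show ?case using piece by simp
next
  case (Suc m)
  have "\<exists>z\<in>{c..d}. constant_sign_on {c..z} (G m) \<and> constant_sign_on {z..d} (G m)"
  proof (rule constant_sign_split[OF \<open>c \<le> d\<close>])
    show "(G m has_real_derivative G (Suc m) x) (at x within {c..d})" if "x \<in> {c..d}" for x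
      by (rule DERIV_subset[OF deriv]) (use that Suc.prems in auto)
    show "constant_sign_on {c..d} (G (Suc m))" using Suc.prems by auto
  qed
  then obtain z where z: "c \<le> z" "z \<le> d" "constant_sign_on {c..z} (G m)" "constant_sign_on {z..d} (G m)"
    by auto
  have sub: "constant_sign_on S (G i)" if "Suc m \<le> i" "i \<le> k" "S \<subseteq> {c..d}" for i S
    using Suc.prems(5)[OF that(1,2)] that(3) unfolding constant_sign_on_def by blast
  have left: "constant_sign_on {c..z} (G i)" and right: "constant_sign_on {z..d} (G i)" if "m \<le> i" "i \<le> k" for i
    using z sub[of i "{c..z}"] sub[of i "{z..d}"] that by (cases "i = m"; simp)+
  have "\<Phi> c z \<le> 2 ^ m * K"
    by (rule Suc.IH) (use Suc.prems z left in auto)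
  moreover have "\<Phi> z d \<le> 2 ^ m * K"
    by (rule Suc.IH) (use Suc.prems z right in auto)
  ultimately show ?case using subadd[of c z d] Suc.prems z by auto
qed

section \<open>The two cases\<close>

lemma comparable_bounds:
  fixes g :: "real \<Rightarrow> real"
  assumes "a \<le> b" and g: "continuous_on {a..b} g" and "A > 0"
    and sup_inf: "(SUP x\<in>{a..b}. \<bar>g x\<bar>) < A * (INF x\<in>{a..b}. \<bar>g x\<bar>)"
  shows "0 < (INF x\<in>{a..b}. \<bar>g x\<bar>)"
    and "x \<in> {a..b} \<Longrightarrow> (INF x\<in>{a..b}. \<bar>g x\<bar>) \<le> \<bar>g x\<bar>"
    and "x \<in> {a..b} \<Longrightarrow> y \<in> {a..b} \<Longrightarrow> \<bar>g x\<bar> \<le> A * \<bar>g y\<bar>"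
    and "x \<in> {a..b} \<Longrightarrow> \<bar>g x\<bar> \<le> (SUP x\<in>{a..b}. \<bar>g x\<bar>)"
proof -
  have bounded: "bounded ((\<lambda>x. \<bar>g x\<bar>) ` {a..b})"
    by (intro compact_imp_bounded compact_continuous_image continuous_on_rabs g compact_Icc)
  then have bdd: "bdd_above ((\<lambda>x. \<bar>g x\<bar>) ` {a..b})" "bdd_below ((\<lambda>x. \<bar>g x\<bar>) ` {a..b})"
    by (simp_all add: bounded_imp_bdd_above bounded_imp_bdd_below)
  show sup: "\<bar>g x\<bar> \<le> (SUP x\<in>{a..b}. \<bar>g x\<bar>)" if "x \<in> {a..b}" for x
    using bdd(1) that by (rule cSUP_upper[rotated])
  show inf: "(INF x\<in>{a..b}. \<bar>g x\<bar>) \<le> \<bar>g x\<bar>" if "x \<in> {a..b}" for x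
    using bdd(2) that by (rule cINF_lower)
  \<comment> \<open>The supremum is nonnegative, so the strict inequality in the hypothesis forces a
    positive infimum and \<open>g\<close> has no zero.\<close>
  have "0 < A * (INF x\<in>{a..b}. \<bar>g x\<bar>)"
    using sup[of a] sup_inf \<open>a \<le> b\<close> by auto
  then show "0 < (INF x\<in>{a..b}. \<bar>g x\<bar>)" using \<open>A > 0\<close> by (simp add: zero_less_mult_iff)
  show "\<bar>g x\<bar> \<le> A * \<bar>g y\<bar>" if "x \<in> {a..b}" "y \<in> {a..b}"
    using sup[OF that(1)] sup_inf mult_left_mono[OF inf[OF that(2)], of A] \<open>A > 0\<close> by linarith
qed

section \<open>First order: covers by intervals of monotonicity\<close>

text \<open>The covering sets may overlap: a nonnegative integrand is counted at least once at each
  point, which suffices for an upper bound.\<close>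

lemma integral_le_sum_of_cover:
  fixes q :: "'a::euclidean_space \<Rightarrow> real"
  assumes "finite I" "S \<subseteq> (\<Union>i\<in>I. J i)" and sub: "\<And>i. i \<in> I \<Longrightarrow> J i \<subseteq> S"
    and q: "q integrable_on S" "\<And>i. i \<in> I \<Longrightarrow> q integrable_on J i" "\<And>x. x \<in> S \<Longrightarrow> 0 \<le> q x"
  shows "integral S q \<le> (\<Sum>i\<in>I. integral (J i) q)"
proof -
  have int: "(\<lambda>x. if x \<in> J i then q x else 0) integrable_on S"
    and eq: "integral S (\<lambda>x. if x \<in> J i then q x else 0) = integral (J i) q" if "i \<in> I" for i
    using sub[OF that] q(2)[OF that]
    by (auto simp: integrable_restrict_Int integral_restrict_Int Int_absorb2)
  have "integral S q \<le> integral S (\<lambda>x. \<Sum>i\<in>I. if x \<in> J i then q x else 0)"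
  proof (rule integral_le)
    show "(\<lambda>x. \<Sum>i\<in>I. if x \<in> J i then q x else 0) integrable_on S"
      by (intro integrable_sum int \<open>finite I\<close>)
    show "q x \<le> (\<Sum>i\<in>I. if x \<in> J i then q x else 0)" if "x \<in> S" for x
    proof -
      obtain i where i: "i \<in> I" "x \<in> J i" using \<open>x \<in> S\<close> assms(2) by auto
      then show ?thesis
        using member_le_sum[of i I "\<lambda>i. if x \<in> J i then q x else 0"] q(3)[OF that] \<open>finite I\<close> by auto
    qed
  qed (rule q)
  also have "\<dots> = (\<Sum>i\<in>I. integral (J i) q)"
    using \<open>finite I\<close> int eq by (simp add: integral_sum)
  finally show ?thesis .
qed

text \<open>An interval of monotonicity may be open, half-open or empty. Its closure is a convenient
  domain of integration, and passing to it leaves the interior, where the sign of the derivative is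
  known, unchanged.\<close>

lemma closure_real_interval_eq_Icc:
  fixes I :: "real set"
  assumes "is_interval I" "I \<subseteq> {a..b}"
  obtains c d where "closure I = {c..d}" "{c..d} \<subseteq> {a..b}" "{c<..<d} = interior I"
proof -
  have sub: "closure I \<subseteq> {a..b}" using assms(2) by (simp add: closure_minimal)
  have "connected (closure I)" "compact (closure I)"
    using assms sub bounded_subset[OF bounded_closed_interval sub]
    by (auto simp: is_interval_connected_1 connected_imp_connected_closure compact_eq_bounded_closed)
  then obtain c d where cd: "closure I = {c..d}"
    using connected_compact_interval_1 by metis
  have "interior I = interior (closure I)"
    using assms(1) by (intro convex_interior_closure[symmetric] is_interval_convex)
  also have "\<dots> = {c<..<d}" by (simp add: cd)
  finally show thesis using that cd sub by blast
qed

lemma monotonic_on_imp_constant_sign_deriv: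
  fixes g h :: "real \<Rightarrow> real"
  assumes "monotonic_on I g" and g: "\<And>x. x \<in> interior I \<Longrightarrow> (g has_real_derivative h x) (at x)"
  shows "(\<forall>x\<in>interior I. 0 \<le> h x) \<or> (\<forall>x\<in>interior I. h x \<le> 0)"
  using assms(1) unfolding monotonic_on_def
proof
  assume "mono_on I g"
  then show ?thesis using mono_on_imp_deriv_nonneg g by blast
next
  assume "antimono_on I g"
  then have "mono_on I (\<lambda>x. - g x)" by (auto simp: monotone_on_def)
  then have "0 \<le> - h x" if "x \<in> interior I" for x
    using mono_on_imp_deriv_nonneg DERIV_minus[OF g[OF that]] that by blast
  then show ?thesis by auto
qed

text \<open>Integration by parts is done once on the whole of \<open>{a..x}\<close>. Its integral
  term is at most the variation of \<open>1 / g\<close> over \<open>{a..b}\<close>, to which each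
  interval of the cover contributes at most \<open>2 / \<mu>\<close>.\<close>

lemma oscillatory_integral_le_of_monotone_cover:
  fixes f g h :: "real \<Rightarrow> real" and I :: "nat \<Rightarrow> real set"
  assumes f: "\<And>x. x \<in> {a..b} \<Longrightarrow> (f has_real_derivative g x) (at x within {a..b})"
    and g: "\<And>x. x \<in> {a..b} \<Longrightarrow> (g has_real_derivative h x) (at x within {a..b})"
    and h: "continuous_on {a..b} h"
    and "\<mu> > 0" and \<mu>: "\<And>x. x \<in> {a..b} \<Longrightarrow> \<mu> \<le> \<bar>g x\<bar>"
    and cover: "(\<Union>i<j. I i) = {a..b}"
    and I: "\<And>i. i < j \<Longrightarrow> is_interval (I i)" "\<And>i. i < j \<Longrightarrow> monotonic_on (I i) g"
    and x: "x \<in> {a..b}"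
  shows "norm (integral {a..x} (\<lambda>x. exp (\<i> * of_real (f x)))) \<le> 4 * real j / \<mu>"
proof -
  have nz: "g x \<noteq> 0" if "x \<in> {a..b}" for x using \<mu>[OF that] \<open>\<mu> > 0\<close> by auto
  have cg: "continuous_on {a..b} g" using g by (blast intro: DERIV_continuous_on)
  define q where "q = (\<lambda>x. \<bar>h x\<bar> / (g x)\<^sup>2)"
  have cq: "continuous_on {a..b} q"
    unfolding q_def by (intro continuous_intros h cg) (use nz in auto)
  have intq: "q integrable_on {c..d}" if "{c..d} \<subseteq> {a..b}" for c d
    using continuous_on_subset[OF cq that] by (rule integrable_continuous_interval)
  have piece: "integral (closure (I i)) q \<le> 2 / \<mu> \<and> q integrable_on closure (I i) \<and> closure (I i) \<subseteq> {a..b}"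
    if i: "i < j" for i
  proof -
    obtain c d where cd: "closure (I i) = {c..d}" "{c..d} \<subseteq> {a..b}" "{c<..<d} = interior (I i)"
      using closure_real_interval_eq_Icc[OF I(1)[OF i], of a b] cover i by blast
    have "integral {c..d} q \<le> 2 / \<mu>"
    proof (cases "c \<le> d")
      case True
      have sgn: "(\<forall>x\<in>{c<..<d}. 0 \<le> h x) \<or> (\<forall>x\<in>{c<..<d}. h x \<le> 0)"
        unfolding cd(3)
      proof (rule monotonic_on_imp_constant_sign_deriv[OF I(2)[OF i]])
        fix x assume "x \<in> interior (I i)"
        then have "x \<in> {c<..<d}" by (simp add: cd(3))
        moreover have "{c<..<d} \<subseteq> interior {a..b}"
          using cd(2) by (intro interior_maximal) auto
        ultimately show "(g has_real_derivative h x) (at x)"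
          using g[of x] interior_subset[of "{a..b}"] by (metis at_within_interior subset_iff)
      qed
      have "integral {c..d} q = \<bar>1 / g c - 1 / g d\<bar>"
        unfolding q_def
        by (intro integral_unique has_integral_abs_deriv_div_square[OF True _ nz sgn])
          (use cd(2) in \<open>auto intro!: DERIV_subset[OF g]\<close>)
      also have "\<dots> \<le> 2 / \<mu>"
        using True cd(2) by (intro abs_inverse_diff_le \<open>\<mu> > 0\<close> \<mu>) auto
      finally show ?thesis .
    qed (use \<open>\<mu> > 0\<close> in simp)
    then show ?thesis using cd intq by simp
  qed
  have "{a..b} \<subseteq> (\<Union>i<j. closure (I i))"
    unfolding cover[symmetric] by (intro UN_mono closure_subset) auto
  then have "integral {a..b} q \<le> (\<Sum>i<j. integral (closure (I i)) q)"
    by (intro integral_le_sum_of_cover) (use piece intq in \<open>auto simp: q_def\<close>)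
  also have "\<dots> \<le> (\<Sum>i<j. 2 / \<mu>)" by (intro sum_mono) (use piece in auto)
  finally have total: "integral {a..b} q \<le> real j * (2 / \<mu>)" by simp
  \<comment> \<open>A nonempty interval needs at least one covering set; this lets
    \<open>real j * (2 / \<mu>)\<close> absorb the boundary term \<open>2 / \<mu>\<close>.\<close>
  have "j \<ge> 1" using cover x by (cases j) auto
  have sub: "{a..x} \<subseteq> {a..b}" using x by auto
  have "norm (integral {a..x} (\<lambda>x. exp (\<i> * of_real (f x)))) \<le> 2 / \<mu> + integral {a..x} q"
    unfolding q_def
    by (rule norm_oscillatory_integral_le_by_parts[OF _ _ _ continuous_on_subset[OF h sub] \<open>\<mu> > 0\<close> \<mu>])
      (use x sub in \<open>auto intro!: DERIV_subset[OF f] DERIV_subset[OF g]\<close>)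
  also have "integral {a..x} q \<le> integral {a..b} q"
    by (intro integral_subset_le intq sub) (auto simp: q_def)
  also have "2 / \<mu> + integral {a..b} q \<le> real j * (2 / \<mu>) + real j * (2 / \<mu>)"
    using total \<open>j \<ge> 1\<close> \<open>\<mu> > 0\<close> by (intro add_mono) (auto simp: field_simps)
  finally show ?thesis by simp
qed

lemma oscillatory_integral_le_first_order:
  fixes f :: "real \<Rightarrow> real" and I :: "nat \<Rightarrow> real set"
  assumes "a < b" "A > 0" and f: "cont_diff_on 2 {a..b} f"
    and sup_inf: "(SUP x\<in>{a..b}. \<bar>deriv_on {a..b} f x\<bar>) < A * (INF x\<in>{a..b}. \<bar>deriv_on {a..b} f x\<bar>)"
    and cover: "(\<Union>i<j. I i) = {a..b}"
    and I: "\<And>i. i < j \<Longrightarrow> is_interval (I i)" "\<And>i. i < j \<Longrightarrow> monotonic_on (I i) (deriv_on {a..b} f)"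
    and x: "x \<in> {a..b}"
  shows "norm (integral {a..x} (\<lambda>x. exp (\<i> * of_real (f x)))) \<le> real j * (4 * max 1 A) * phase_bound a b f"
proof -
  define g where "g = deriv_on {a..b} f"
  define h where "h = higher_deriv_on 2 {a..b} f"
  define M where "M = (SUP x\<in>{a..b}. \<bar>g x\<bar>)"
  define \<mu> where "\<mu> = (INF x\<in>{a..b}. \<bar>g x\<bar>)"
  have f': "(f has_real_derivative g x) (at x within {a..b})"
    and g': "(g has_real_derivative h x) (at x within {a..b})" if "x \<in> {a..b}" for x
    using has_real_derivative_higher_deriv_on[OF f _ that, of 0]
      has_real_derivative_higher_deriv_on[OF f _ that, of 1]
    by (simp_all add: g_def h_def higher_deriv_on_def numeral_2_eq_2)
  have ch: "continuous_on {a..b} h" unfolding h_def using f by (rule cont_diff_on_imp_continuous_on) simp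
  have cf: "continuous_on {a..b} f" and cg: "continuous_on {a..b} g"
    using f' g' by (blast intro: DERIV_continuous_on)+
  note bounds = comparable_bounds[OF less_imp_le[OF \<open>a < b\<close>] cg \<open>A > 0\<close> sup_inf[folded g_def],
      folded \<mu>_def M_def]
  have "M > 0" using bounds(1) bounds(2)[of a] bounds(4)[of a] \<open>a < b\<close> by auto
  let ?N = "norm (integral {a..x} (\<lambda>x. exp (\<i> * of_real (f x))))"
  have "j \<ge> 1" using cover x by (cases j) auto
  \<comment> \<open>The hypothesis reads \<open>M < A * \<mu>\<close>; dividing converts the bound
    in terms of the infimum into one in terms of the supremum.\<close>
  have "1 / \<mu> \<le> A / M"
    using sup_inf bounds(1) \<open>M > 0\<close> by (simp add: field_simps M_def \<mu>_def g_def)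
  have "?N \<le> 4 * real j * (1 / \<mu>)"
    using oscillatory_integral_le_of_monotone_cover[OF f' g' ch bounds(1,2) cover I(1) _ x] I(2)
    by (simp add: g_def)
  also have "\<dots> \<le> 4 * real j * (max 1 A / M)"
    using \<open>1 / \<mu> \<le> A / M\<close> \<open>M > 0\<close>
    by (intro mult_left_mono order_trans[OF \<open>1 / \<mu> \<le> A / M\<close>] divide_right_mono) auto
  finally have 1: "?N \<le> real j * (4 * max 1 A) * (1 / M)" by (simp add: mult_ac)
  have "?N \<le> x - a"
    using x by (intro norm_oscillatory_integral_le_length continuous_on_subset[OF cf]) auto
  also have "\<dots> \<le> 1 * (b - a)" using x by simp
  \<comment> \<open>Taking \<open>max 1 A\<close> makes the constant at least 1, so the trivial
    bound by length fits under it and both entries of the minimum are covered.\<close>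
  also have "\<dots> \<le> real j * (4 * max 1 A) * (b - a)"
  proof (rule mult_right_mono)
    have "1 * 1 \<le> real j * (4 * max 1 A)" using \<open>j \<ge> 1\<close> by (intro mult_mono) auto
    then show "1 \<le> real j * (4 * max 1 A)" by simp
  qed (use \<open>a < b\<close> in simp)
  finally have "?N \<le> real j * (4 * max 1 A) * min (b - a) (1 / M)"
    using 1 by (simp add: min_def)
  also have "\<dots> \<le> real j * (4 * max 1 A) * phase_bound a b f"
    using phase_bound_ge(2)[OF less_imp_le[OF \<open>a < b\<close>] f] unfolding M_def g_def
    by (intro mult_left_mono) auto
  finally show ?thesis .
qed

section \<open>Higher order: summing over the pieces of constant sign\<close>

lemma oscillatory_integral_le_higher_order:
  fixes f :: "real \<Rightarrow> real"
  assumes "a < b" "2 \<le> k" "A > 0" and f: "cont_diff_on k {a..b} f"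
    and sup_inf: "(SUP x\<in>{a..b}. \<bar>higher_deriv_on k {a..b} f x\<bar>) < A * (INF x\<in>{a..b}. \<bar>higher_deriv_on k {a..b} f x\<bar>)"
    and x: "x \<in> {a..b}"
  shows "norm (integral {a..x} (\<lambda>x. exp (\<i> * of_real (f x))))
    \<le> 2 ^ (k - 1) * (20 * max 1 (landau_const A (k - 1) 1)) * phase_bound a b f"
proof -
  define C where "C = max 1 (landau_const A (k - 1) 1)"
  define \<Phi> where "\<Phi> = (\<lambda>c d. norm (integral {c..d} (\<lambda>x. exp (\<i> * complex_of_real (f x)))))"
  \<comment> \<open>Indexing starts at the first derivative, so the derivative of order
    \<open>k\<close> is \<open>G (k - 1)\<close> and only \<open>k - 1\<close> rounds of cutting are
    needed.\<close>
  define G where "G = (\<lambda>i. higher_deriv_on (Suc i) {a..b} f)"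
  have k: "Suc (k - 1) = k" "0 < k - 1" using \<open>2 \<le> k\<close> by simp_all
  have G': "(G i has_real_derivative G (Suc i) x) (at x within {a..b})" if "i < k - 1" "x \<in> {a..b}" for i x
    unfolding G_def using f that by (intro has_real_derivative_higher_deriv_on) auto
  have f': "(f has_real_derivative G 0 x) (at x within {a..b})" if "x \<in> {a..b}" for x
    using has_real_derivative_higher_deriv_on[OF f _ that, of 0] k
    by (simp add: G_def higher_deriv_on_def)
  have G0: "G 0 = deriv_on {a..b} f" by (simp add: G_def higher_deriv_on_def)
  have cf: "continuous_on {a..b} f" using f' by (blast intro: DERIV_continuous_on)
  have cG: "continuous_on {a..b} (G i)" if "i \<le> k - 1" for i
    unfolding G_def using f that k by (intro cont_diff_on_imp_continuous_on[OF f]) auto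
  note bounds = comparable_bounds[OF less_imp_le[OF \<open>a < b\<close>]
      cont_diff_on_imp_continuous_on[OF f order_refl] \<open>A > 0\<close> sup_inf]
  have f2: "cont_diff_on 2 {a..b} f" using f \<open>2 \<le> k\<close> by (rule cont_diff_on_two)
  have pb: "0 \<le> phase_bound a b f"
    using phase_bound_ge(1)[OF less_imp_le[OF \<open>a < b\<close>] f2] integral_curvature_min_nonneg[OF f2] by simp
  have "\<Phi> a x \<le> 2 ^ (k - 1) * (20 * C * phase_bound a b f)"
  proof (rule bound_of_constant_sign_pieces[where \<Phi> = \<Phi> and G = G and k = "k - 1" and a = a and b = b])
    show "\<Phi> c d \<le> \<Phi> c z + \<Phi> z d" if "a \<le> c" "c \<le> z" "z \<le> d" "d \<le> b" for c z d
    proof -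
      have "(\<lambda>x. exp (\<i> * complex_of_real (f x))) integrable_on {c..d}"
        by (intro integrable_continuous_interval continuous_intros continuous_on_subset[OF cf])
          (use that in auto)
      then show ?thesis unfolding \<Phi>_def
        using Henstock_Kurzweil_Integration.integral_combine[OF that(2,3)] norm_triangle_ineq by metis
    qed
    show "\<Phi> c d \<le> 20 * C * phase_bound a b f"
      if cd: "a \<le> c" "c \<le> d" "d \<le> b" and sgn: "\<And>i. i \<le> k - 1 \<Longrightarrow> constant_sign_on {c..d} (G i)" for c d
    proof (cases "c = d")
      case True
      then show ?thesis using pb by (simp add: \<Phi>_def C_def)
    next
      case False
      then have "c < d" using cd by simp
      have sub: "{c..d} \<subseteq> {a..b}" using cd by auto
      have f1: "(f has_real_derivative G 0 y) (at y within {c..d})"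
        and g1: "(G 0 has_real_derivative G 1 y) (at y within {c..d})" if "y \<in> {c..d}" for y
        using DERIV_subset[OF f' sub, of y] DERIV_subset[OF G' sub, of 0 y] that sub k by auto
      have h1: "continuous_on {c..d} (G 1)" by (rule continuous_on_subset[OF cG sub]) (use k in simp)
      obtain u v where uv: "c \<le> u" "u < v" "v \<le> d" "\<forall>x\<in>{u..v}. \<bar>G 0 x\<bar> \<le> 1 / (v - u)"
          "\<Phi> c d \<le> 5 * (v - u)"
        using oscillatory_integral_le_flat_length[OF \<open>c < d\<close> f1 g1 h1 sgn[of 0] sgn[of 1]] k unfolding \<Phi>_def by fastforce
      have "v - u \<le> 4 * C * phase_bound a b f"
        unfolding C_def
        by (rule flat_length_le_phase_bound[OF \<open>a < b\<close> \<open>2 \<le> k\<close> f _ bounds(3)])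
          (use uv cd \<open>A > 0\<close> in \<open>auto simp: G0\<close>)
      \<comment> \<open>The constant 20 is the product of 5, from the piece, and 4, from the flat
        length. The flat interval lies in the piece, but its length is estimated by the phase bound
        of all of \<open>{a..b}\<close>.\<close>
      then have "5 * (v - u) \<le> 5 * (4 * C * phase_bound a b f)" by (rule mult_left_mono) simp
      then show ?thesis using uv(5) by simp
    qed
    show "constant_sign_on {a..x} (G i)" if "k - 1 \<le> i" "i \<le> k - 1" for i
    \<comment> \<open>The cutting starts from the top derivative, which is bounded away from 0 and
      so has one sign on the whole interval.\<close>
    proof (rule continuous_nonvanishing_constant_sign)
      have i: "i = k - 1" using that by simp
      show "continuous_on {a..x} (G i)" using cG[OF that(2)] by (rule continuous_on_subset) (use x in auto)
      show "G i y \<noteq> 0" if "y \<in> {a..x}" for y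
        using bounds(1) bounds(2)[of y] that x unfolding G_def i k by auto
    qed
  qed (use G' x in auto)
  then show ?thesis by (simp add: \<Phi>_def C_def mult.assoc)
qed

theorem theorem1p1:
  fixes k :: nat and A :: real
  assumes "k \<ge> 1" and "A > 0"
  shows "\<exists>B>0. \<forall>(a::real) (b::real) (f::real \<Rightarrow> real) (\<phi>::real \<Rightarrow> complex).
      a < b \<and> cont_diff_on (max k 2) {a..b} f \<and>
      (SUP x\<in>{a..b}. \<bar>higher_deriv_on k {a..b} f x\<bar>)
        < A * (INF x\<in>{a..b}. \<bar>higher_deriv_on k {a..b} f x\<bar>) \<and>
      cont_diff_on 1 {a..b} \<phi> \<longrightarrow>
      (k \<ge> 2 \<longrightarrow>
        norm (integral {a..b} (\<lambda>x. exp (\<i> * complex_of_real (f x)) * \<phi> x))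
          \<le> B * amplitude_norm a b \<phi> * phase_bound a b f) \<and>
      (k = 1 \<longrightarrow>
        (\<forall>(j::nat) (I::nat \<Rightarrow> real set).
          (\<Union>i<j. I i) = {a..b} \<and>
          (\<forall>i<j. is_interval (I i) \<and> monotonic_on (I i) (deriv_on {a..b} f)) \<longrightarrow>
          norm (integral {a..b} (\<lambda>x. exp (\<i> * complex_of_real (f x)) * \<phi> x))
            \<le> real j * B * amplitude_norm a b \<phi> * phase_bound a b f))"
proof -
  \<comment> \<open>Both constants involve only \<open>A\<close> and \<open>k\<close>, so
    \<open>B\<close> is fixed before the interval, the phase and the amplitude.\<close>
  define B where "B = (if k = 1 then 4 * max 1 A else 2 ^ (k - 1) * (20 * max 1 (landau_const A (k - 1) 1)))"
  have "B > 0" by (simp add: B_def)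
  moreover have "(k \<ge> 2 \<longrightarrow>
        norm (integral {a..b} (\<lambda>x. exp (\<i> * complex_of_real (f x)) * \<phi> x))
          \<le> B * amplitude_norm a b \<phi> * phase_bound a b f) \<and>
      (k = 1 \<longrightarrow>
        (\<forall>(j::nat) (I::nat \<Rightarrow> real set).
          (\<Union>i<j. I i) = {a..b} \<and>
          (\<forall>i<j. is_interval (I i) \<and> monotonic_on (I i) (deriv_on {a..b} f)) \<longrightarrow>
          norm (integral {a..b} (\<lambda>x. exp (\<i> * complex_of_real (f x)) * \<phi> x))
            \<le> real j * B * amplitude_norm a b \<phi> * phase_bound a b f))"
    if "a < b" and f: "cont_diff_on (max k 2) {a..b} f"
      and sup_inf: "(SUP x\<in>{a..b}. \<bar>higher_deriv_on k {a..b} f x\<bar>)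
        < A * (INF x\<in>{a..b}. \<bar>higher_deriv_on k {a..b} f x\<bar>)"
      and \<phi>: "cont_diff_on 1 {a..b} \<phi>"
    for a b :: real and f :: "real \<Rightarrow> real" and \<phi> :: "real \<Rightarrow> complex"
  proof -
    have "continuous_on {a..b} f"
      using cont_diff_on_imp_continuous_on[OF f, of 0] by (simp add: higher_deriv_on_def)
    then have "continuous_on {a..b} (\<lambda>x. exp (\<i> * complex_of_real (f x)))"
      by (intro continuous_intros)
    \<comment> \<open>Both cases now reduce to a bound, uniform in \<open>x\<close>, for the
      integral over \<open>{a..x}\<close> without amplitude.\<close>
    note amplitude = norm_integral_mult_le_amplitude_norm[OF \<open>a < b\<close> this \<phi>]
    show ?thesis
    proof (intro conjI impI allI)
      assume "2 \<le> k"
      then have "norm (integral {a..x} (\<lambda>x. exp (\<i> * complex_of_real (f x)))) \<le> B * phase_bound a b f"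
        if "x \<in> {a..b}" for x
        using oscillatory_integral_le_higher_order[OF \<open>a < b\<close> _ \<open>A > 0\<close> _ sup_inf that] f
        by (simp add: B_def max_absorb1)
      from amplitude[OF this] show "norm (integral {a..b} (\<lambda>x. exp (\<i> * complex_of_real (f x)) * \<phi> x))
          \<le> B * amplitude_norm a b \<phi> * phase_bound a b f"
        by (simp add: mult_ac)
    next
      fix j and I :: "nat \<Rightarrow> real set"
      assume "k = 1" and I: "(\<Union>i<j. I i) = {a..b} \<and>
          (\<forall>i<j. is_interval (I i) \<and> monotonic_on (I i) (deriv_on {a..b} f))"
      have "norm (integral {a..x} (\<lambda>x. exp (\<i> * complex_of_real (f x)))) \<le> real j * B * phase_bound a b f"
        if "x \<in> {a..b}" for x
        using oscillatory_integral_le_first_order[OF \<open>a < b\<close> \<open>A > 0\<close>, of f I j x] f sup_inf I that \<open>k = 1\<close>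
        by (simp add: B_def higher_deriv_on_def numeral_2_eq_2)
      from amplitude[OF this] show "norm (integral {a..b} (\<lambda>x. exp (\<i> * complex_of_real (f x)) * \<phi> x))
            \<le> real j * B * amplitude_norm a b \<phi> * phase_bound a b f"
        by (simp add: mult_ac)
    qed
  qed
  ultimately show ?thesis by blast
qed

end
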